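(* For all positive integers $k$, $$\begin{aligned}\rho(G_k^{\mathfrak{gl}(n+1)})={}&\left(\sum_{g=0}^{k-1}\binom kg R_1^gR_2^{k-1-g}\right)(\mathcal E\otimes1)+(n+1)R_1^k+\sum_{g=0}^{k-1}\binom kg R_1^g\left(1\otimes G_{k-g}^{\mathfrak{gl}(n)}\right)\\&-\sum_{m=2}^k\left(\sum_{g=0}^{k-m}\binom kg R_1^gR_2^{k-m-g}\right)\left(1\otimes G_{m-1}^{\mathfrak{gl}(n)}\right).\end{aligned}$$
   Context: The base field is $\mathbb C$ and $n$ is a fixed positive integer. $E_{ij}$ are the elementary matrices; indices run over $1,\dots,n$ for $\mathfrak{gl}(n)$ and over $0,\dots,n$ for $\mathfrak{gl}(n+1)$. A sum $\sum_{i=r}^s$ with $r>s$ is $0$. $\mathcal D'(n)$ is the subalgebra of the algebra of differential operators on $\mathbb C[t_0^{\pm1},t_1,\dots,t_n]$ generated by $\frac{t_i}{t_0}$ ($1\le i\le n$) and $t_0\partial_j$ ($0\le j\le n$), where $\partial_j=\partial/\partial t_j$; $\mathcal E=\sum_{i=0}^n t_i\partial_i$. The Gelfand invariant of degree $k\ge1$ of $\mathfrak{gl}(N)$, $N\in\{n,n+1\}$, is $G_k^{\mathfrak{gl}(N)}=\operatorname{tr}(\mathbf E_N^k)=\sum_{i_1,\dots,i_k}E_{i_1i_2}E_{i_2i_3}\cdots E_{i_ki_1}\in U(\mathfrak{gl}(N))$, where $\mathbf E_N$ is the matrix with $(i,j)$ entry $E_{ij}$ and the indices run over $1,\dots,n$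 if $N=n$ and over $0,\dots,n$ if $N=n+1$. Put $R_1=-\frac1{n+1}\left(\mathcal E\otimes1+1\otimes G_1^{\mathfrak{gl}(n)}\right)$ and $R_2=(\mathcal E+n)\otimes1$, both central in $\mathcal D'(n)\otimes U(\mathfrak{gl}(n))$. The map $\rho:U(\mathfrak{gl}(n+1))\to\mathcal D'(n)\otimes U(\mathfrak{gl}(n))$ is the homomorphism of associative unital algebras determined by $E_{ab}\mapsto t_a\partial_b\otimes1+1\otimes E_{ab}+\delta_{ab}R_1$ for $a,b>0$; $E_{a0}\mapsto t_a\partial_0\otimes1-\sum_{i>0}\frac{t_i}{t_0}\otimes E_{ai}$ for $a>0$; $E_{0b}\mapsto t_0\partial_b\otimes1$ for $b>0$; $E_{00}\mapsto t_0\partial_0\otimes1+R_1$. *)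

theory Defs
  imports "HOL-Analysis.Analysis" "HOL-Library.Poly_Mapping"
begin

section \<open>Unital associative complex algebras\<close>

class calgebra_1 = ring_1 +
  fixes cscale :: "complex \<Rightarrow> 'a \<Rightarrow> 'a" (infixr \<open>*\<^sub>C\<close> 75)
  assumes cscale_add_right: "c *\<^sub>C (x + y) = c *\<^sub>C x + c *\<^sub>C y"
    and cscale_add_left: "(c + d) *\<^sub>C x = c *\<^sub>C x + d *\<^sub>C x"
    and cscale_cscale [simp]: "c *\<^sub>C d *\<^sub>C x = (c * d) *\<^sub>C x"
    and cscale_one [simp]: "1 *\<^sub>C x = x"
    and cscale_mult_left [simp]: "(c *\<^sub>C x) * y = c *\<^sub>C (x * y)"
    and cscale_mult_right [simp]: "x * (c *\<^sub>C y) = c *\<^sub>C (x * y)"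

definition calgebra_hom :: "('a::calgebra_1 \<Rightarrow> 'b::calgebra_1) \<Rightarrow> bool"
  where "calgebra_hom f \<longleftrightarrow>
    (\<forall>x y. f (x + y) = f x + f y) \<and> (\<forall>c x. f (c *\<^sub>C x) = c *\<^sub>C f x) \<and>
    (\<forall>x y. f (x * y) = f x * f y) \<and> f 1 = 1"

interpretation calg: vector_space "cscale :: complex \<Rightarrow> 'a::calgebra_1 \<Rightarrow> 'a"
  by unfold_locales (simp_all add: cscale_add_right cscale_add_left)

instantiation complex :: calgebra_1
begin
definition cscale_complex :: "complex \<Rightarrow> complex \<Rightarrow> complex"
  where "cscale_complex = (\<lambda>c x. c * x)"
instance
  by standard (simp_all add: cscale_complex_def algebra_simps)
end

lemma poly_mapping_induct_single [case_names zero single add]: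
  fixes p :: "'x \<Rightarrow>\<^sub>0 'a::comm_monoid_add"
  assumes "P 0" "\<And>x c. P (Poly_Mapping.single x c)" "\<And>p q. P p \<Longrightarrow> P q \<Longrightarrow> P (p + q)"
  shows "P p"
proof -
  have "p = (\<Sum>x\<in>Poly_Mapping.keys p. Poly_Mapping.single x (Poly_Mapping.lookup p x))"
    by (rule poly_mapping_eqI)
      (auto simp: lookup_sum lookup_single when_def in_keys_iff)
  moreover have "P (\<Sum>x\<in>A. Poly_Mapping.single x (Poly_Mapping.lookup p x))" if "finite A" for A
    using that by induction (use assms in auto)
  ultimately show ?thesis
    by (metis finite_keys)
qed

definition cextend :: "('x \<Rightarrow> 'a::calgebra_1) \<Rightarrow> ('x \<Rightarrow>\<^sub>0 complex) \<Rightarrow> 'a"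
  where "cextend f p = (\<Sum>x\<in>Poly_Mapping.keys p. Poly_Mapping.lookup p x *\<^sub>C f x)"

lemma cextend_superset:
  assumes "finite A" "Poly_Mapping.keys p \<subseteq> A"
  shows "cextend f p = (\<Sum>x\<in>A. Poly_Mapping.lookup p x *\<^sub>C f x)"
  unfolding cextend_def
  by (rule sum.mono_neutral_left) (use assms in \<open>auto simp: in_keys_iff\<close>)

lemma cextend_zero [simp]: "cextend f 0 = 0"
  by (simp add: cextend_def)

lemma cextend_single [simp]: "cextend f (Poly_Mapping.single x c) = c *\<^sub>C f x"
  by (simp add: cextend_def)

lemma cextend_add: "cextend f (p + q) = cextend f p + cextend f q"
proof -
  let ?A = "Poly_Mapping.keys p \<union> Poly_Mapping.keys q"
  have "cextend f (p + q) = (\<Sum>x\<in>?A. Poly_Mapping.lookup (p + q) x *\<^sub>C f x)"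
    by (rule cextend_superset) (auto dest: set_mp[OF Poly_Mapping.keys_add])
  also have "\<dots> = cextend f p + cextend f q"
    by (simp add: lookup_add cscale_add_left sum.distrib cextend_superset[of ?A])
  finally show ?thesis .
qed

lemma cextend_uminus: "cextend f (- p) = - cextend f p"
  using cextend_add[of f p "- p"] by (simp add: eq_neg_iff_add_eq_0 add.commute)

lemma cextend_diff: "cextend f (p - q) = cextend f p - cextend f q"
  using cextend_add[of f p "- q"] by (simp add: cextend_uminus)

lemma cextend_mult:
  fixes f :: "'x::monoid_add \<Rightarrow> 'a::calgebra_1"
  assumes "\<And>x y. f (x + y) = f x * f y"
  shows "cextend f (p * q) = cextend f p * cextend f q"
proof (induction p rule: poly_mapping_induct_single)
  case (single x c)
  show ?case
    by (induction q rule: poly_mapping_induct_single)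
      (simp_all add: assms mult_single cextend_add distrib_left mult.commute)
qed (simp_all add: cextend_add distrib_right)

lemma cextend_scale:
  "cextend f (Poly_Mapping.single 0 c * p) = c *\<^sub>C cextend (f :: 'x::monoid_add \<Rightarrow> 'a::calgebra_1) p"
  by (induction p rule: poly_mapping_induct_single)
    (simp_all add: mult_single cextend_add distrib_left cscale_add_right)

lemma single_zero_central:
  "p * Poly_Mapping.single 0 c = Poly_Mapping.single 0 c * (p :: 'x::monoid_add \<Rightarrow>\<^sub>0 'a::comm_ring_1)"
  by (induction p rule: poly_mapping_induct_single)
    (simp_all add: mult_single distrib_left distrib_right mult.commute)


section \<open>The universal enveloping algebra of \<open>gl(m)\<close>\<close>

text \<open>
  The free monoid on \<open>'x\<close>, written additively so that \<open>'x word \<Rightarrow>\<^sub>0 complex\<close>, with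
  the convolution product of \<^theory>\<open>HOL-Library.Poly_Mapping\<close>, is the free associative
  algebra on \<open>'x\<close>.
\<close>

datatype 'x word = Word (letters: "'x list")

instantiation word :: (type) monoid_add
begin
definition zero_word :: "'a word" where "zero_word = Word []"
definition plus_word :: "'a word \<Rightarrow> 'a word \<Rightarrow> 'a word"
  where "plus_word v w = Word (letters v @ letters w)"
instance
  by standard (simp_all add: zero_word_def plus_word_def)
end

definition letter :: "'x \<Rightarrow> 'x word \<Rightarrow>\<^sub>0 complex"
  where "letter x = Poly_Mapping.single (Word [x]) 1"

inductive_set two_sided_ideal :: "'r::ring_1 set \<Rightarrow> 'r set" for S
  where
    ideal_base: "x \<in> S \<Longrightarrow> x \<in> two_sided_ideal S"
  | ideal_zero: "0 \<in> two_sided_ideal S"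
  | ideal_add: "x \<in> two_sided_ideal S \<Longrightarrow> y \<in> two_sided_ideal S \<Longrightarrow> x + y \<in> two_sided_ideal S"
  | ideal_left: "x \<in> two_sided_ideal S \<Longrightarrow> r * x \<in> two_sided_ideal S"
  | ideal_right: "x \<in> two_sided_ideal S \<Longrightarrow> x * r \<in> two_sided_ideal S"

definition mat_cscale :: "complex \<Rightarrow> complex^'m^'m \<Rightarrow> complex^'m^'m"
  where "mat_cscale c A = (\<chi> i j. c * A $ i $ j)"

text \<open>
  \<open>gl(m)\<close> is \<open>complex^'m^'m\<close> with the commutator bracket, and its enveloping algebra is
  the tensor algebra of \<open>gl(m)\<close>, i.e. the free algebra on the set \<open>gl(m)\<close> modulo
  linearity, further divided by the relations \<open>A B - B A = [A, B]\<close>.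
\<close>

definition ugl_relations :: "((complex^'m::finite^'m) word \<Rightarrow>\<^sub>0 complex) set"
  where "ugl_relations =
    {letter (A + B) - letter A - letter B | A B. True} \<union>
    {letter (mat_cscale c A) - Poly_Mapping.single 0 c * letter A | c A. True} \<union>
    {letter A * letter B - letter B * letter A - letter (A ** B - B ** A) | A B. True}"

definition ugl_equiv ::
    "((complex^'m::finite^'m) word \<Rightarrow>\<^sub>0 complex) \<Rightarrow> ((complex^'m^'m) word \<Rightarrow>\<^sub>0 complex) \<Rightarrow> bool"
  where "ugl_equiv x y \<longleftrightarrow> x - y \<in> two_sided_ideal ugl_relations"

lemma ideal_uminus: "x \<in> two_sided_ideal S \<Longrightarrow> - x \<in> two_sided_ideal S"
  using ideal_left[of x S "- 1"] by simp

lemma ideal_cong_add: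
  assumes "a - b \<in> two_sided_ideal S" "c - d \<in> two_sided_ideal S"
  shows "(a + c) - (b + d) \<in> two_sided_ideal S"
  using ideal_add[OF assms] by (simp add: algebra_simps)

lemma ideal_cong_uminus:
  assumes "a - b \<in> two_sided_ideal S"
  shows "(- a) - (- b) \<in> two_sided_ideal S"
  using ideal_uminus[OF assms] by (simp add: algebra_simps)

lemma ideal_cong_mult:
  assumes "a - b \<in> two_sided_ideal S" "c - d \<in> two_sided_ideal S"
  shows "(a * c) - (b * d) \<in> two_sided_ideal S"
  using ideal_add[OF ideal_right[OF assms(1), of c] ideal_left[OF assms(2), of b]]
  by (simp add: algebra_simps)

lemma equivp_ugl_equiv: "equivp ugl_equiv"
proof (rule equivpI)
  show "reflp ugl_equiv"
    by (simp add: reflp_def ugl_equiv_def ideal_zero)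
  show "symp ugl_equiv"
    unfolding symp_def ugl_equiv_def by (auto dest: ideal_uminus)
  show "transp ugl_equiv"
    unfolding transp_def ugl_equiv_def by (auto dest: ideal_add)
qed

definition word_eval :: "('x \<Rightarrow> 'a::calgebra_1) \<Rightarrow> 'x word \<Rightarrow> 'a"
  where "word_eval f w = prod_list (map f (letters w))"

lemma word_eval_add: "word_eval f (v + w) = word_eval f v * word_eval f w"
  by (simp add: word_eval_def plus_word_def)

lemma word_eval_zero [simp]: "word_eval f 0 = 1"
  by (simp add: word_eval_def zero_word_def)

definition free_eval :: "('x \<Rightarrow> 'a::calgebra_1) \<Rightarrow> ('x word \<Rightarrow>\<^sub>0 complex) \<Rightarrow> 'a"
  where "free_eval f = cextend (word_eval f)"

lemma free_eval_add: "free_eval f (p + q) = free_eval f p + free_eval f q"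
  and free_eval_diff: "free_eval f (p - q) = free_eval f p - free_eval f q"
  and free_eval_mult: "free_eval f (p * q) = free_eval f p * free_eval f q"
  and free_eval_scale: "free_eval f (Poly_Mapping.single 0 c * p) = c *\<^sub>C free_eval f p"
  and free_eval_zero [simp]: "free_eval f 0 = 0"
  and free_eval_letter [simp]: "free_eval f (letter x) = f x"
  unfolding free_eval_def
  by (simp_all add: cextend_add cextend_diff cextend_mult cextend_scale word_eval_add letter_def)
    (simp add: word_eval_def)

lemma free_eval_const [simp]: "free_eval f (Poly_Mapping.single 0 c) = c *\<^sub>C 1"
  by (simp add: free_eval_def)

lemma free_eval_one [simp]: "free_eval f 1 = 1"
  using cextend_single[of "word_eval f" 0 1] by (simp add: free_eval_def)

definition gl_lie_hom :: "(complex^'m::finite^'m \<Rightarrow> 'a::calgebra_1) \<Rightarrow> bool"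
  where "gl_lie_hom f \<longleftrightarrow>
    (\<forall>A B. f (A + B) = f A + f B) \<and> (\<forall>c A. f (mat_cscale c A) = c *\<^sub>C f A) \<and>
    (\<forall>A B. f (A ** B - B ** A) = f A * f B - f B * f A)"

lemma free_eval_ideal:
  assumes "gl_lie_hom f" "x \<in> two_sided_ideal ugl_relations"
  shows "free_eval f x = 0"
  using assms(2)
proof induction
  case (ideal_base x)
  then show ?case
    using assms(1)
    by (auto simp: ugl_relations_def gl_lie_hom_def free_eval_diff free_eval_mult free_eval_scale)
qed (simp_all add: free_eval_add free_eval_mult)

lemma ugl_equiv_eqI: "x = y \<Longrightarrow> ugl_equiv x y"
  by (simp add: ugl_equiv_def ideal_zero)

quotient_type 'm ugl = "(complex^'m::finite^'m) word \<Rightarrow>\<^sub>0 complex" / ugl_equiv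
  by (rule equivp_ugl_equiv)

instantiation ugl :: (finite) calgebra_1
begin

lift_definition zero_ugl :: "'a ugl" is 0 .
lift_definition one_ugl :: "'a ugl" is 1 .
lift_definition plus_ugl :: "'a ugl \<Rightarrow> 'a ugl \<Rightarrow> 'a ugl" is "(+)"
  unfolding ugl_equiv_def by (rule ideal_cong_add)
lift_definition uminus_ugl :: "'a ugl \<Rightarrow> 'a ugl" is uminus
  unfolding ugl_equiv_def by (rule ideal_cong_uminus)
lift_definition minus_ugl :: "'a ugl \<Rightarrow> 'a ugl \<Rightarrow> 'a ugl" is "(-)"
  unfolding ugl_equiv_def
  using ideal_cong_add[OF _ ideal_cong_uminus] by simp
lift_definition times_ugl :: "'a ugl \<Rightarrow> 'a ugl \<Rightarrow> 'a ugl" is times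
  unfolding ugl_equiv_def by (rule ideal_cong_mult)
lift_definition cscale_ugl :: "complex \<Rightarrow> 'a ugl \<Rightarrow> 'a ugl"
  is "\<lambda>c x. Poly_Mapping.single 0 c * x"
  unfolding ugl_equiv_def by (simp only: ideal_left flip: right_diff_distrib)

instance
proof
  show "(0::'a ugl) \<noteq> 1"
  proof transfer
    show "\<not> ugl_equiv 0 (1 :: (complex^'a^'a) word \<Rightarrow>\<^sub>0 complex)"
    proof
      assume "ugl_equiv 0 (1 :: (complex^'a^'a) word \<Rightarrow>\<^sub>0 complex)"
      then have "free_eval (\<lambda>_::complex^'a^'a. 0::complex) (0 - 1) = 0"
        unfolding ugl_equiv_def
        by (intro free_eval_ideal) (simp_all add: gl_lie_hom_def cscale_complex_def)
      then show False
        by (simp only: free_eval_diff) simp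
    qed
  qed
next
  fix a b c :: "'a ugl" and r t :: complex
  show "a + b + c = a + (b + c)"
    by transfer (rule ugl_equiv_eqI, simp add: add.assoc)
  show "a + b = b + a"
    by transfer (rule ugl_equiv_eqI, simp add: add.commute)
  show "0 + a = a"
    by transfer (rule ugl_equiv_eqI, simp)
  show "- a + a = 0"
    by transfer (rule ugl_equiv_eqI, simp)
  show "a - b = a + - b"
    by transfer (rule ugl_equiv_eqI, simp)
  show "a * b * c = a * (b * c)"
    by transfer (rule ugl_equiv_eqI, simp add: mult.assoc)
  show "1 * a = a"
    by transfer (rule ugl_equiv_eqI, simp)
  show "a * 1 = a"
    by transfer (rule ugl_equiv_eqI, simp)
  show "(a + b) * c = a * c + b * c"
    by transfer (rule ugl_equiv_eqI, simp add: distrib_right)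
  show "a * (b + c) = a * b + a * c"
    by transfer (rule ugl_equiv_eqI, simp add: distrib_left)
  show "r *\<^sub>C (a + b) = r *\<^sub>C a + r *\<^sub>C b"
    by transfer (rule ugl_equiv_eqI, simp add: distrib_left)
  show "(r + t) *\<^sub>C a = r *\<^sub>C a + t *\<^sub>C a"
    by transfer (rule ugl_equiv_eqI, simp add: single_add distrib_right)
  show "r *\<^sub>C t *\<^sub>C a = (r * t) *\<^sub>C a"
    by transfer (rule ugl_equiv_eqI, simp add: mult_single mult.assoc[symmetric])
  show "1 *\<^sub>C a = a"
    by transfer (rule ugl_equiv_eqI, simp)
  show "(r *\<^sub>C a) * b = r *\<^sub>C (a * b)"
    by transfer (rule ugl_equiv_eqI, simp add: mult.assoc)
  show "a * (r *\<^sub>C b) = r *\<^sub>C (a * b)"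
    by transfer (rule ugl_equiv_eqI, simp only: mult.assoc[symmetric] single_zero_central)
qed

end


section \<open>Tensor products of complex algebras\<close>

text \<open>
  The multiplicative monoid of \<open>A \<times> B\<close>, written additively, so that
  \<open>('a, 'b) pure \<Rightarrow>\<^sub>0 complex\<close> is the vector space with basis \<open>A \<times> B\<close> equipped with the
  product \<open>(a, b) (a', b') = (a a', b b')\<close>.
\<close>

datatype ('a, 'b) pure = Pure 'a 'b

instantiation pure :: (calgebra_1, calgebra_1) monoid_add
begin
definition zero_pure :: "('a, 'b) pure" where "zero_pure = Pure 1 1"
definition plus_pure :: "('a, 'b) pure \<Rightarrow> ('a, 'b) pure \<Rightarrow> ('a, 'b) pure"
  where "plus_pure x y = (case x of Pure a b \<Rightarrow> case y of Pure a' b' \<Rightarrow> Pure (a * a') (b * b'))"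
instance
  by standard (simp_all add: zero_pure_def plus_pure_def mult.assoc split: pure.splits)
end

text \<open>
  The span of the bilinearity relations. It is a two-sided ideal
  (\<open>tensor_null_left\<close>, \<open>tensor_null_right\<close> below).
\<close>

inductive_set tensor_null :: "(('a::calgebra_1, 'b::calgebra_1) pure \<Rightarrow>\<^sub>0 complex) set"
  where
    null_add_left: "Poly_Mapping.single (Pure (a + a') b) 1
        - Poly_Mapping.single (Pure a b) 1 - Poly_Mapping.single (Pure a' b) 1 \<in> tensor_null"
  | null_add_right: "Poly_Mapping.single (Pure a (b + b')) 1
        - Poly_Mapping.single (Pure a b) 1 - Poly_Mapping.single (Pure a b') 1 \<in> tensor_null"
  | null_scale_left: "Poly_Mapping.single (Pure (c *\<^sub>C a) b) 1
        - Poly_Mapping.single (Pure a b) c \<in> tensor_null"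
  | null_scale_right: "Poly_Mapping.single (Pure a (c *\<^sub>C b)) 1
        - Poly_Mapping.single (Pure a b) c \<in> tensor_null"
  | null_zero: "0 \<in> tensor_null"
  | null_add: "x \<in> tensor_null \<Longrightarrow> y \<in> tensor_null \<Longrightarrow> x + y \<in> tensor_null"
  | null_scale: "x \<in> tensor_null \<Longrightarrow> Poly_Mapping.single 0 c * x \<in> tensor_null"

definition tensor_equiv ::
    "(('a::calgebra_1, 'b::calgebra_1) pure \<Rightarrow>\<^sub>0 complex) \<Rightarrow> (('a, 'b) pure \<Rightarrow>\<^sub>0 complex) \<Rightarrow> bool"
  where "tensor_equiv x y \<longleftrightarrow> x - y \<in> tensor_null"

lemma single_eq_scale: "Poly_Mapping.single (x::'x::monoid_add) (c::complex) =
    Poly_Mapping.single 0 c * Poly_Mapping.single x 1"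
  by (simp add: mult_single)

lemma tensor_null_left_single:
  assumes "x \<in> tensor_null"
  shows "Poly_Mapping.single (Pure p q) 1 * x \<in> tensor_null"
  using assms
proof induction
  case (null_add x y)
  then show ?case by (simp add: distrib_left tensor_null.null_add)
next
  case (null_scale x c)
  then show ?case
    by (simp add: single_zero_central tensor_null.null_scale flip: mult.assoc)
      (simp add: mult.assoc tensor_null.null_scale)
qed (simp_all add: right_diff_distrib mult_single plus_pure_def distrib_left
      tensor_null.null_zero tensor_null.null_add_left tensor_null.null_add_right
      tensor_null.null_scale_left tensor_null.null_scale_right)

lemma tensor_null_right_single:
  assumes "x \<in> tensor_null"
  shows "x * Poly_Mapping.single (Pure p q) 1 \<in> tensor_null"
  using assms
proof induction
  case (null_add x y)
  then show ?case by (simp add: distrib_right tensor_null.null_add)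
next
  case (null_scale x c)
  then show ?case
    by (simp add: mult.assoc tensor_null.null_scale)
qed (simp_all add: left_diff_distrib mult_single plus_pure_def distrib_right
      tensor_null.null_zero tensor_null.null_add_left tensor_null.null_add_right
      tensor_null.null_scale_left tensor_null.null_scale_right)

lemma tensor_null_left: "x \<in> tensor_null \<Longrightarrow> r * x \<in> tensor_null"
proof (induction r rule: poly_mapping_induct_single)
  case (single e c)
  obtain p q where e: "e = Pure p q" by (cases e)
  have "Poly_Mapping.single e c * x
      = Poly_Mapping.single 0 c * (Poly_Mapping.single e 1 * x)"
    by (subst single_eq_scale) (simp add: mult.assoc)
  with single show ?case
    by (simp add: null_scale tensor_null_left_single e)
qed (simp_all add: distrib_right null_add null_zero)

lemma tensor_null_right: "x \<in> tensor_null \<Longrightarrow> x * r \<in> tensor_null"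
proof (induction r rule: poly_mapping_induct_single)
  case (single e c)
  obtain p q where e: "e = Pure p q" by (cases e)
  have "x * Poly_Mapping.single e c
      = Poly_Mapping.single 0 c * (x * Poly_Mapping.single e 1)"
    by (subst single_eq_scale) (simp add: single_zero_central flip: mult.assoc)
  with single show ?case
    by (simp add: null_scale tensor_null_right_single e)
qed (simp_all add: distrib_left null_add null_zero)

lemma tensor_null_uminus: "x \<in> tensor_null \<Longrightarrow> - x \<in> tensor_null"
  using tensor_null_left[of x "- 1"] by simp

lemma equivp_tensor_equiv: "equivp tensor_equiv"
proof (rule equivpI)
  show "reflp tensor_equiv"
    by (simp add: reflp_def tensor_equiv_def null_zero)
  show "symp tensor_equiv"
    unfolding symp_def tensor_equiv_def by (auto dest: tensor_null_uminus)
  show "transp tensor_equiv"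
    unfolding transp_def tensor_equiv_def by (auto dest: null_add)
qed

lemma tensor_equiv_eqI: "x = y \<Longrightarrow> tensor_equiv x y"
  by (simp add: tensor_equiv_def null_zero)

lemma ex_unit_functional:
  "\<exists>f :: 'a::calgebra_1 \<Rightarrow> complex.
    (\<forall>x y. f (x + y) = f x + f y) \<and> (\<forall>c x. f (c *\<^sub>C x) = c * f x) \<and> f 1 = 1"
proof -
  interpret P: vector_space_pair "cscale :: complex \<Rightarrow> 'a \<Rightarrow> 'a" "cscale :: complex \<Rightarrow> complex \<Rightarrow> complex"
    by unfold_locales
  have "\<not> calg.dependent {1::'a}"
    by (simp add: calg.dependent_single)
  then obtain g where "Vector_Spaces.linear cscale cscale g" "\<forall>x\<in>{1::'a}. g x = (1::complex)"
    using P.linear_independent_extend[of "{1}" "\<lambda>_. 1"] by auto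
  then show ?thesis
    by (intro exI[of _ g])
      (auto simp: Vector_Spaces.linear_iff cscale_complex_def)
qed

lemma one_notin_tensor_null:
  "1 \<notin> (tensor_null :: (('a::calgebra_1, 'b::calgebra_1) pure \<Rightarrow>\<^sub>0 complex) set)"
proof
  assume one: "1 \<in> (tensor_null :: (('a, 'b) pure \<Rightarrow>\<^sub>0 complex) set)"
  obtain f :: "'a \<Rightarrow> complex" where f: "\<And>x y. f (x + y) = f x + f y" "\<And>c x. f (c *\<^sub>C x) = c * f x" "f 1 = 1"
    using ex_unit_functional by blast
  obtain g :: "'b \<Rightarrow> complex" where g: "\<And>x y. g (x + y) = g x + g y" "\<And>c x. g (c *\<^sub>C x) = c * g x" "g 1 = 1"
    using ex_unit_functional by blast
  define h where "h = (\<lambda>x. case x of Pure a b \<Rightarrow> f a * g b)"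
  have "cextend h x = 0" if "x \<in> tensor_null" for x
    using that
  proof induction
    case (null_scale x c)
    have "cextend h (Poly_Mapping.single 0 c * x) = c * cextend h x"
      by (induction x rule: poly_mapping_induct_single)
        (simp_all add: mult_single cextend_add distrib_left cscale_complex_def)
    with null_scale show ?case by simp
  qed (simp_all add: cextend_add cextend_diff h_def f g cscale_complex_def algebra_simps)
  from this[OF one] show False
    using cextend_single[of h 0 1] unfolding single_one
    by (simp add: h_def zero_pure_def f g cscale_complex_def)
qed

quotient_type (overloaded) ('a, 'b) tensor =
    "('a::calgebra_1, 'b::calgebra_1) pure \<Rightarrow>\<^sub>0 complex" / tensor_equiv
  by (rule equivp_tensor_equiv)

instantiation tensor :: (calgebra_1, calgebra_1) calgebra_1
begin

lift_definition zero_tensor :: "('a, 'b) tensor" is 0 .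
lift_definition one_tensor :: "('a, 'b) tensor" is 1 .
lift_definition plus_tensor :: "('a, 'b) tensor \<Rightarrow> ('a, 'b) tensor \<Rightarrow> ('a, 'b) tensor" is "(+)"
proof -
  fix x y z w :: "('a, 'b) pure \<Rightarrow>\<^sub>0 complex"
  assume "tensor_equiv x y" "tensor_equiv z w"
  then have "(x - y) + (z - w) \<in> tensor_null"
    unfolding tensor_equiv_def by (rule null_add)
  then show "tensor_equiv (x + z) (y + w)"
    by (simp add: tensor_equiv_def algebra_simps)
qed
lift_definition uminus_tensor :: "('a, 'b) tensor \<Rightarrow> ('a, 'b) tensor" is uminus
proof -
  fix x y :: "('a, 'b) pure \<Rightarrow>\<^sub>0 complex"
  assume "tensor_equiv x y"
  then have "- (x - y) \<in> tensor_null"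
    unfolding tensor_equiv_def by (rule tensor_null_uminus)
  then show "tensor_equiv (- x) (- y)"
    by (simp add: tensor_equiv_def)
qed
lift_definition minus_tensor :: "('a, 'b) tensor \<Rightarrow> ('a, 'b) tensor \<Rightarrow> ('a, 'b) tensor" is "(-)"
proof -
  fix x y z w :: "('a, 'b) pure \<Rightarrow>\<^sub>0 complex"
  assume "tensor_equiv x y" "tensor_equiv z w"
  then have "(x - y) + - (z - w) \<in> tensor_null"
    unfolding tensor_equiv_def by (intro null_add tensor_null_uminus)
  then show "tensor_equiv (x - z) (y - w)"
    by (simp add: tensor_equiv_def algebra_simps)
qed
lift_definition times_tensor :: "('a, 'b) tensor \<Rightarrow> ('a, 'b) tensor \<Rightarrow> ('a, 'b) tensor" is times
proof -
  fix x y z w :: "('a, 'b) pure \<Rightarrow>\<^sub>0 complex"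
  assume "tensor_equiv x y" "tensor_equiv z w"
  then have "(x - y) * z + y * (z - w) \<in> tensor_null"
    unfolding tensor_equiv_def by (intro null_add tensor_null_left tensor_null_right)
  then show "tensor_equiv (x * z) (y * w)"
    by (simp add: tensor_equiv_def algebra_simps)
qed
lift_definition cscale_tensor :: "complex \<Rightarrow> ('a, 'b) tensor \<Rightarrow> ('a, 'b) tensor"
  is "\<lambda>c x. Poly_Mapping.single 0 c * x"
  unfolding tensor_equiv_def by (simp only: null_scale flip: right_diff_distrib)

instance
proof
  show "(0::('a, 'b) tensor) \<noteq> 1"
    by transfer (use one_notin_tensor_null tensor_null_uminus in \<open>force simp: tensor_equiv_def\<close>)
next
  fix a b c :: "('a, 'b) tensor" and r t :: complex
  show "a + b + c = a + (b + c)"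
    by transfer (rule tensor_equiv_eqI, simp add: add.assoc)
  show "a + b = b + a"
    by transfer (rule tensor_equiv_eqI, simp add: add.commute)
  show "0 + a = a"
    by transfer (rule tensor_equiv_eqI, simp)
  show "- a + a = 0"
    by transfer (rule tensor_equiv_eqI, simp)
  show "a - b = a + - b"
    by transfer (rule tensor_equiv_eqI, simp)
  show "a * b * c = a * (b * c)"
    by transfer (rule tensor_equiv_eqI, simp add: mult.assoc)
  show "1 * a = a"
    by transfer (rule tensor_equiv_eqI, simp)
  show "a * 1 = a"
    by transfer (rule tensor_equiv_eqI, simp)
  show "(a + b) * c = a * c + b * c"
    by transfer (rule tensor_equiv_eqI, simp add: distrib_right)
  show "a * (b + c) = a * b + a * c"
    by transfer (rule tensor_equiv_eqI, simp add: distrib_left)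
  show "r *\<^sub>C (a + b) = r *\<^sub>C a + r *\<^sub>C b"
    by transfer (rule tensor_equiv_eqI, simp add: distrib_left)
  show "(r + t) *\<^sub>C a = r *\<^sub>C a + t *\<^sub>C a"
    by transfer (rule tensor_equiv_eqI, simp add: single_add distrib_right)
  show "r *\<^sub>C t *\<^sub>C a = (r * t) *\<^sub>C a"
    by transfer (rule tensor_equiv_eqI, simp add: mult_single mult.assoc[symmetric])
  show "1 *\<^sub>C a = a"
    by transfer (rule tensor_equiv_eqI, simp)
  show "(r *\<^sub>C a) * b = r *\<^sub>C (a * b)"
    by transfer (rule tensor_equiv_eqI, simp add: mult.assoc)
  show "a * (r *\<^sub>C b) = r *\<^sub>C (a * b)"
    by transfer (rule tensor_equiv_eqI, simp only: mult.assoc[symmetric] single_zero_central)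
qed

end

lift_definition tensor :: "'a::calgebra_1 \<Rightarrow> 'b::calgebra_1 \<Rightarrow> ('a, 'b) tensor" (infix \<open>\<otimes>\<close> 75)
  is "\<lambda>a b. Poly_Mapping.single (Pure a b) 1" .

lemma tensor_add_left: "(a + a') \<otimes> b = a \<otimes> b + a' \<otimes> b"
  by transfer (simp add: tensor_equiv_def null_add_left flip: diff_diff_eq)

lemma tensor_add_right: "a \<otimes> (b + b') = a \<otimes> b + a \<otimes> b'"
  by transfer (simp add: tensor_equiv_def null_add_right flip: diff_diff_eq)

lemma tensor_scale_left: "(c *\<^sub>C a) \<otimes> b = c *\<^sub>C (a \<otimes> b)"
  by transfer (simp add: tensor_equiv_def null_scale_left mult_single)

lemma tensor_scale_right: "a \<otimes> (c *\<^sub>C b) = c *\<^sub>C (a \<otimes> b)"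
  by transfer (simp add: tensor_equiv_def null_scale_right mult_single)

lemma tensor_mult: "(a \<otimes> b) * (a' \<otimes> b') = (a * a') \<otimes> (b * b')"
  by transfer (simp add: tensor_equiv_def null_zero mult_single plus_pure_def)

lemma tensor_one: "1 \<otimes> 1 = 1"
  by transfer (rule tensor_equiv_eqI, simp flip: zero_pure_def)


section \<open>The algebra \<open>D'(n)\<close>\<close>

text \<open>
  The type \<open>'n\<close> plays the role of the index set \<open>{1, \<dots>, n}\<close>, so that \<open>n = CARD('n)\<close>, and
  \<open>'n option\<close> that of \<open>{0, \<dots>, n}\<close>, with \<open>None\<close> for the index \<open>0\<close>. A Laurent polynomial
  in \<open>t\<^sub>0\<^sup>\<plusminus>\<^sup>1, t\<^sub>1, \<dots>, t\<^sub>n\<close> is a finitely supported family of coefficients, indexed by the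
  exponent of \<open>t\<^sub>0\<close> and the exponents of the other variables.
\<close>

type_synonym 'n expo = "int \<times> ('n \<Rightarrow>\<^sub>0 nat)"
type_synonym 'n laurent = "'n expo \<Rightarrow>\<^sub>0 complex"

fun t_var :: "'n option \<Rightarrow> 'n laurent"
  where
    "t_var None = Poly_Mapping.single (1, 0) 1"
  | "t_var (Some i) = Poly_Mapping.single (0, Poly_Mapping.single i 1) 1"

declare t_var.simps [simp del]

definition t0_inv :: "'n laurent"
  where "t0_inv = Poly_Mapping.single (- 1, 0) 1"

text \<open>
  The derivative of a monomial. The subtraction of exponents in the second equation is
  truncated only when the coefficient vanishes.
\<close>

fun monom_deriv :: "'n option \<Rightarrow> 'n expo \<Rightarrow> 'n laurent"
  where
    "monom_deriv None (k, m) = Poly_Mapping.single (k - 1, m) (of_int k)"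
  | "monom_deriv (Some i) (k, m) =
      Poly_Mapping.single (k, m - Poly_Mapping.single i 1) (of_nat (Poly_Mapping.lookup m i))"

definition partial :: "'n option \<Rightarrow> 'n laurent \<Rightarrow> 'n laurent"
  where "partial j p =
    (\<Sum>e\<in>Poly_Mapping.keys p. Poly_Mapping.single 0 (Poly_Mapping.lookup p e) * monom_deriv j e)"

lemma partial_superset:
  assumes "finite A" "Poly_Mapping.keys p \<subseteq> A"
  shows "partial j p =
    (\<Sum>e\<in>A. Poly_Mapping.single 0 (Poly_Mapping.lookup p e) * monom_deriv j e)"
  unfolding partial_def
  by (rule sum.mono_neutral_left) (use assms in \<open>auto simp: in_keys_iff\<close>)

lemma partial_zero [simp]: "partial j 0 = 0"
  by (simp add: partial_def)

lemma partial_single: "partial j (Poly_Mapping.single e c) = Poly_Mapping.single 0 c * monom_deriv j e"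
  by (simp add: partial_def)

lemma partial_add: "partial j (p + q) = partial j p + partial j q"
proof -
  let ?A = "Poly_Mapping.keys p \<union> Poly_Mapping.keys q"
  have "partial j (p + q) =
      (\<Sum>e\<in>?A. Poly_Mapping.single 0 (Poly_Mapping.lookup (p + q) e) * monom_deriv j e)"
    by (rule partial_superset) (auto dest: set_mp[OF Poly_Mapping.keys_add])
  also have "\<dots> = partial j p + partial j q"
    by (simp add: lookup_add single_add distrib_right sum.distrib partial_superset[of ?A])
  finally show ?thesis .
qed

lemma diff_single_add:
  assumes "Poly_Mapping.lookup m i > 0"
  shows "(m - Poly_Mapping.single i 1) + m' = (m + m') - Poly_Mapping.single i (1::nat)"
  by (rule poly_mapping_eqI)
    (use assms in \<open>auto simp: lookup_add lookup_minus lookup_single when_def\<close>)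

lemma monom_deriv_add:
  "monom_deriv j (e + e') =
    Poly_Mapping.single e 1 * monom_deriv j e' + monom_deriv j e * Poly_Mapping.single e' 1"
proof -
  obtain k m k' m' where e: "e = (k, m)" "e' = (k', m')" by (cases e, cases e')
  show ?thesis
  proof (cases j)
    case None
    then show ?thesis
      by (simp add: e mult_single algebra_simps flip: single_add)
  next
    case (Some i)
    have *: "Poly_Mapping.single (k + k', m + (m' - Poly_Mapping.single i 1)) (of_nat (Poly_Mapping.lookup m' i) :: complex)
        = Poly_Mapping.single (k + k', (m + m') - Poly_Mapping.single i 1) (of_nat (Poly_Mapping.lookup m' i))"
      using diff_single_add[of m' i m] by (cases "Poly_Mapping.lookup m' i = 0") (auto simp: add.commute)
    have **: "Poly_Mapping.single (k + k', (m - Poly_Mapping.single i 1) + m') (of_nat (Poly_Mapping.lookup m i) :: complex)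
        = Poly_Mapping.single (k + k', (m + m') - Poly_Mapping.single i 1) (of_nat (Poly_Mapping.lookup m i))"
      using diff_single_add[of m i m'] by (cases "Poly_Mapping.lookup m i = 0") auto
    show ?thesis
      using * ** by (simp add: Some e mult_single lookup_add single_add add.commute)
  qed
qed

lemma partial_mult: "partial j (p * q) = p * partial j q + partial j p * q"
proof (induction p rule: poly_mapping_induct_single)
  case (single e c)
  show ?case
  proof (induction q rule: poly_mapping_induct_single)
    case (single e' c')
    have "partial j (Poly_Mapping.single e c * Poly_Mapping.single e' c') =
        Poly_Mapping.single 0 c * Poly_Mapping.single 0 c' *
          (Poly_Mapping.single e 1 * monom_deriv j e' + monom_deriv j e * Poly_Mapping.single e' 1)"
      by (simp add: mult_single partial_single monom_deriv_add)
    also have "\<dots> = (Poly_Mapping.single 0 c * Poly_Mapping.single e 1) * (Poly_Mapping.single 0 c' * monom_deriv j e')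
        + (Poly_Mapping.single 0 c * monom_deriv j e) * (Poly_Mapping.single 0 c' * Poly_Mapping.single e' 1)"
      by (simp only: algebra_simps)
    finally show ?case
      by (simp add: mult_single partial_single)
  qed (simp_all add: partial_add algebra_simps)
qed (simp_all add: partial_add algebra_simps)

lemma partial_scalar: "partial j (Poly_Mapping.single 0 c) = 0"
  by (cases j) (simp_all add: partial_single zero_prod_def)

lemma partial_one [simp]: "partial j 1 = 0"
  using partial_scalar[of j 1] by simp

lemma partial_scale: "partial j (Poly_Mapping.single 0 c * p) = Poly_Mapping.single 0 c * partial j p"
  by (simp add: partial_mult partial_scalar)

lemma partial_commute: "partial i (partial j p) = partial j (partial i p)"
proof (induction p rule: poly_mapping_induct_single)
  case (single e c)
  obtain k m where e: "e = (k, m)" by (cases e)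
  show ?case
  proof (cases "i = j")
    case False
    then show ?thesis
      by (cases i; cases j)
        (simp_all add: partial_single partial_scale e mult_single lookup_minus lookup_single
          diff_diff_eq add.commute mult.commute mult.left_commute mult.assoc)
  qed simp
qed (simp_all add: partial_add)

lemma partial_t_var: "partial i (t_var j) = (if i = j then 1 else 0)"
  by (cases i; cases j)
    (simp_all add: t_var.simps partial_single lookup_single when_def mult_single flip: zero_prod_def)

lemma t0_inv_t_var [simp]: "t0_inv * t_var None = 1"
  by (simp add: t_var.simps t0_inv_def mult_single flip: zero_prod_def)

lemma partial_t0_inv: "partial i t0_inv = (if i = None then - (t0_inv * t0_inv) else 0)"
  by (cases i) (simp_all add: t0_inv_def partial_single mult_single single_uminus)

inductive_set Dprime :: "('n laurent \<Rightarrow> 'n laurent) set"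
  where
    Dprime_scalar: "(\<lambda>f. Poly_Mapping.single 0 c * f) \<in> Dprime"
  | Dprime_ratio: "(\<lambda>f. t_var (Some i) * t0_inv * f) \<in> Dprime"
  | Dprime_partial: "(\<lambda>f. t_var None * partial j f) \<in> Dprime"
  | Dprime_add: "D \<in> Dprime \<Longrightarrow> D' \<in> Dprime \<Longrightarrow> (\<lambda>f. D f + D' f) \<in> Dprime"
  | Dprime_comp: "D \<in> Dprime \<Longrightarrow> D' \<in> Dprime \<Longrightarrow> (\<lambda>f. D (D' f)) \<in> Dprime"

typedef 'n dprime = "Dprime :: ('n laurent \<Rightarrow> 'n laurent) set"
  by (rule exI) (rule Dprime_scalar)

setup_lifting type_definition_dprime

lemma Dprime_linear:
  assumes "D \<in> Dprime"
  shows "D (p + q) = D p + D q" "D (Poly_Mapping.single 0 c * p) = Poly_Mapping.single 0 c * D p"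
proof -
  have "(\<forall>p q. D (p + q) = D p + D q) \<and>
      (\<forall>c p. D (Poly_Mapping.single 0 c * p) = Poly_Mapping.single 0 c * D p)"
    using assms
    by (induction rule: Dprime.induct) (simp_all add: partial_add partial_scale distrib_left mult.left_commute)
  then show "D (p + q) = D p + D q" "D (Poly_Mapping.single 0 c * p) = Poly_Mapping.single 0 c * D p"
    by auto
qed

lemma Dprime_scale: "D \<in> Dprime \<Longrightarrow> (\<lambda>f. Poly_Mapping.single 0 c * D f) \<in> Dprime"
  by (rule Dprime_comp[OF Dprime_scalar])

lemma Dprime_uminus: "D \<in> Dprime \<Longrightarrow> (\<lambda>f. - D f) \<in> Dprime"
  using Dprime_scale[of D "- 1"] by (simp add: single_uminus)

instantiation dprime :: (type) calgebra_1
begin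

lift_definition zero_dprime :: "'a dprime" is "\<lambda>f. 0"
proof -
  have eq: "(\<lambda>f. Poly_Mapping.single 0 0 * f) = (\<lambda>f :: 'a laurent. 0)"
    by (rule ext) simp
  show "(\<lambda>f :: 'a laurent. 0) \<in> Dprime"
    by (rule subst[OF eq, of "\<lambda>D. D \<in> Dprime"]) (rule Dprime_scalar)
qed
lift_definition one_dprime :: "'a dprime" is "\<lambda>f. f"
proof -
  have eq: "(\<lambda>f. Poly_Mapping.single 0 1 * f) = (\<lambda>f :: 'a laurent. f)"
    by (rule ext) simp
  show "(\<lambda>f :: 'a laurent. f) \<in> Dprime"
    by (rule subst[OF eq, of "\<lambda>D. D \<in> Dprime"]) (rule Dprime_scalar)
qed
lift_definition plus_dprime :: "'a dprime \<Rightarrow> 'a dprime \<Rightarrow> 'a dprime" is "\<lambda>D D' f. D f + D' f"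
  by (rule Dprime_add)
lift_definition uminus_dprime :: "'a dprime \<Rightarrow> 'a dprime" is "\<lambda>D f. - D f"
  by (rule Dprime_uminus)
lift_definition minus_dprime :: "'a dprime \<Rightarrow> 'a dprime \<Rightarrow> 'a dprime" is "\<lambda>D D' f. D f - D' f"
  using Dprime_add[OF _ Dprime_uminus] by simp
lift_definition times_dprime :: "'a dprime \<Rightarrow> 'a dprime \<Rightarrow> 'a dprime" is "\<lambda>D D' f. D (D' f)"
  by (rule Dprime_comp)
lift_definition cscale_dprime :: "complex \<Rightarrow> 'a dprime \<Rightarrow> 'a dprime"
  is "\<lambda>c D f. Poly_Mapping.single 0 c * D f"
  by (rule Dprime_scale)

instance
proof
  show "(0::'a dprime) \<noteq> 1"
    by transfer (metis zero_neq_one)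
next
  fix a b c :: "'a dprime" and r t :: complex
  show "a + b + c = a + (b + c)"
    by transfer (simp add: add.assoc)
  show "a + b = b + a"
    by transfer (simp add: add.commute)
  show "0 + a = a"
    by transfer (simp)
  show "- a + a = 0"
    by transfer (simp)
  show "a - b = a + - b"
    by transfer (simp)
  show "a * b * c = a * (b * c)"
    by transfer (simp)
  show "1 * a = a"
    by transfer (simp)
  show "a * 1 = a"
    by transfer (simp)
  show "(a + b) * c = a * c + b * c"
    by transfer (simp)
  show "a * (b + c) = a * b + a * c"
    by transfer (simp add: Dprime_linear)
  show "r *\<^sub>C (a + b) = r *\<^sub>C a + r *\<^sub>C b"
    by transfer (simp add: distrib_left)
  show "(r + t) *\<^sub>C a = r *\<^sub>C a + t *\<^sub>C a"
    by transfer (simp add: single_add distrib_right)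
  show "r *\<^sub>C t *\<^sub>C a = (r * t) *\<^sub>C a"
    by transfer (simp add: mult_single mult.assoc[symmetric])
  show "1 *\<^sub>C a = a"
    by transfer (simp)
  show "(r *\<^sub>C a) * b = r *\<^sub>C (a * b)"
    by transfer (simp)
  show "a * (r *\<^sub>C b) = r *\<^sub>C (a * b)"
    by transfer (simp add: Dprime_linear)
qed

end

lift_definition t_ratio :: "'n \<Rightarrow> 'n dprime" is "\<lambda>i f. t_var (Some i) * t0_inv * f"
  by (rule Dprime_ratio)

lift_definition t_partial :: "'n option \<Rightarrow> 'n option \<Rightarrow> 'n dprime" is "\<lambda>a b f. t_var a * partial b f"
proof -
  fix a b :: "'n option"
  show "(\<lambda>f. t_var a * partial b f) \<in> Dprime"
  proof (cases a)
    case None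
    then show ?thesis by (simp only: Dprime_partial)
  next
    case (Some i)
    have "(\<lambda>f. t_var (Some i) * t0_inv * (t_var None * partial b f)) =
        (\<lambda>f. t_var (Some i) * (t0_inv * t_var None) * partial b f)"
      by (simp only: mult.assoc)
    then show ?thesis
      using Dprime_comp[OF Dprime_ratio[of i] Dprime_partial[of b]] by (simp add: Some)
  qed
qed

definition euler :: "'n::finite dprime"
  where "euler = (\<Sum>i\<in>UNIV. t_partial i i)"

lemma t_partial_commutator:
  "t_partial a b * t_partial c d - t_partial c d * t_partial a b =
    (if b = c then t_partial a d else 0) - (if d = a then t_partial c b else 0)"
  by transfer
    (auto simp: fun_eq_iff partial_mult partial_t_var partial_commute algebra_simps)

lemma t_ratio_commute: "t_ratio i * t_ratio j = t_ratio j * t_ratio i"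
  by transfer (simp add: fun_eq_iff algebra_simps)

lemma dprime_eqI: "(\<And>f. Rep_dprime D f = Rep_dprime D' f) \<Longrightarrow> D = D'"
  by (simp add: Rep_dprime_inject[symmetric] fun_eq_iff)

lemma t_partial_ratio_commutator:
  fixes i a b :: "'n"
  shows "t_partial None (Some b) * t_ratio i - t_ratio i * t_partial None (Some b) = (if b = i then 1 else 0)"
  "t_partial (Some a) (Some b) * t_ratio i - t_ratio i * t_partial (Some a) (Some b) = (if b = i then t_ratio a else 0)"
  "t_partial None None * t_ratio i - t_ratio i * t_partial None None = - t_ratio i"
  "t_partial (Some a) None * t_ratio i - t_ratio i * t_partial (Some a) None = - (t_ratio a * t_ratio i)"
proof -
  have inv2: "t0_inv * (t_var None * x) = x" for x :: "'n laurent"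
    by (simp flip: mult.assoc)
  then have inv1: "t_var None * (t0_inv * x) = x" for x :: "'n laurent"
    by (simp add: mult.left_commute)
  have der: "t_var a * partial b (t_var (Some i) * t0_inv * f) - t_var (Some i) * t0_inv * (t_var a * partial b f)
      = t_var a * partial b (t_var (Some i) * t0_inv) * f" for a b and f :: "'n laurent"
  proof -
    have "T * (U * P + Q * f) - U * (T * P) = T * Q * f" for T U P Q :: "'n laurent"
      by (simp only: distrib_left mult.assoc mult.left_commute[of U T P] add_diff_cancel_left')
    then show ?thesis
      unfolding partial_mult[of _ "t_var (Some i) * t0_inv" f] .
  qed
  have d1: "partial (Some b) (t_var (Some i) * t0_inv) = (if b = i then t0_inv else 0)"
    by (simp add: partial_mult partial_t_var partial_t0_inv)
  have d0: "partial None (t_var (Some i) * t0_inv) = - (t_var (Some i) * (t0_inv * t0_inv))"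
    by (simp add: partial_mult partial_t_var partial_t0_inv)
  note rep_eqs = minus_dprime.rep_eq times_dprime.rep_eq t_partial.rep_eq t_ratio.rep_eq
    uminus_dprime.rep_eq one_dprime.rep_eq zero_dprime.rep_eq
  show "t_partial None (Some b) * t_ratio i - t_ratio i * t_partial None (Some b) = (if b = i then 1 else 0)"
    by (rule dprime_eqI) (simp add: rep_eqs der d1 inv1[of 1, simplified])
  show "t_partial (Some a) (Some b) * t_ratio i - t_ratio i * t_partial (Some a) (Some b) = (if b = i then t_ratio a else 0)"
    by (intro dprime_eqI) (simp add: rep_eqs der d1)
  have "t_var None * (- (t_var (Some i) * (t0_inv * t0_inv))) * f = - (t_var (Some i) * t0_inv * f)" for f
  proof -
    have "t_var None * (- (t_var (Some i) * (t0_inv * t0_inv))) * f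
        = - (t_var (Some i) * (t0_inv * (t0_inv * (t_var None * f))))"
      by (simp add: ac_simps)
    then show ?thesis
      by (simp only: inv2 mult.assoc)
  qed
  then show "t_partial None None * t_ratio i - t_ratio i * t_partial None None = - t_ratio i"
    by (intro dprime_eqI) (simp only: rep_eqs der d0)
  have "t_var (Some a) * (- (t_var (Some i) * (t0_inv * t0_inv))) * f
      = - (t_var (Some a) * t0_inv * (t_var (Some i) * t0_inv * f))" for f
    by (simp add: ac_simps)
  then show "t_partial (Some a) None * t_ratio i - t_ratio i * t_partial (Some a) None = - (t_ratio a * t_ratio i)"
    by (intro dprime_eqI) (simp only: rep_eqs der d0)
qed


section \<open>Gelfand invariants and the homomorphism \<open>\<rho>\<close>\<close>

lift_definition ugl_incl :: "complex^'m::finite^'m \<Rightarrow> 'm ugl" is letter .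

definition elem_mat :: "'m \<Rightarrow> 'm \<Rightarrow> complex^'m::finite^'m"
  where "elem_mat i j = (\<chi> k l. if k = i \<and> l = j then 1 else 0)"

definition UE :: "'m \<Rightarrow> 'm \<Rightarrow> 'm::finite ugl"
  where "UE i j = ugl_incl (elem_mat i j)"

definition UE_matrix :: "('m::finite ugl)^'m^'m"
  where "UE_matrix = (\<chi> i j. UE i j)"

text \<open>The power is the one for the matrix product \<open>**\<close>; \<open>^\<close> on \<open>vec\<close> is componentwise.\<close>

definition gelfand :: "nat \<Rightarrow> 'm::finite ugl"
  where "gelfand k = trace (((\<lambda>M. UE_matrix ** M) ^^ k) (mat 1))"

definition R1 :: "('n::finite dprime, 'n ugl) tensor"
  where "R1 = (- 1 / of_nat (CARD('n) + 1)) *\<^sub>C (euler \<otimes> 1 + 1 \<otimes> gelfand 1)"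

definition R2 :: "('n::finite dprime, 'n ugl) tensor"
  where "R2 = (euler + of_nat CARD('n)) \<otimes> 1"

fun rho_gen :: "'n option \<Rightarrow> 'n option \<Rightarrow> ('n::finite dprime, 'n ugl) tensor"
  where
    "rho_gen (Some a) (Some b) =
      t_partial (Some a) (Some b) \<otimes> 1 + 1 \<otimes> UE a b + (if a = b then R1 else 0)"
  | "rho_gen (Some a) None =
      t_partial (Some a) None \<otimes> 1 - (\<Sum>i\<in>UNIV. t_ratio i \<otimes> UE a i)"
  | "rho_gen None (Some b) = t_partial None (Some b) \<otimes> 1"
  | "rho_gen None None = t_partial None None \<otimes> 1 + R1"

text \<open>Existence and uniqueness are proved in \<open>rho_ex1\<close> below.\<close>

definition rho :: "'n option ugl \<Rightarrow> ('n::finite dprime, 'n ugl) tensor"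
  where "rho = (THE f. calgebra_hom f \<and> (\<forall>i j. f (UE i j) = rho_gen i j))"


subsection \<open>The universal property of \<open>U(gl(m))\<close>\<close>

lemma ugl_incl_add: "ugl_incl (A + B) = ugl_incl A + ugl_incl B"
  by transfer
    (auto simp: ugl_equiv_def diff_diff_eq[symmetric] ugl_relations_def intro!: ideal_base)

lemma ugl_incl_scale: "ugl_incl (mat_cscale c A) = c *\<^sub>C ugl_incl A"
  by transfer (auto simp: ugl_equiv_def ugl_relations_def intro!: ideal_base)

lemma ugl_incl_bracket: "ugl_incl (A ** B - B ** A) = ugl_incl A * ugl_incl B - ugl_incl B * ugl_incl A"
proof -
  have "ugl_incl A * ugl_incl B - ugl_incl B * ugl_incl A = ugl_incl (A ** B - B ** A)"
    by transfer (auto simp: ugl_equiv_def ugl_relations_def intro!: ideal_base)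
  then show ?thesis by simp
qed

lemma ugl_incl_lie_hom: "gl_lie_hom ugl_incl"
  by (simp add: gl_lie_hom_def ugl_incl_add ugl_incl_scale ugl_incl_bracket)

lemma abs_ugl_eq:
  fixes p :: "(complex^'m::finite^'m) word \<Rightarrow>\<^sub>0 complex"
  shows "abs_ugl p = free_eval ugl_incl p"
proof (induction p rule: poly_mapping_induct_single)
  case zero
  then show ?case by (simp flip: zero_ugl.abs_eq)
next
  case (add p q)
  then show ?case by (simp add: free_eval_add flip: plus_ugl.abs_eq)
next
  case (single w c)
  have "abs_ugl (Poly_Mapping.single (Word xs) c) = c *\<^sub>C prod_list (map ugl_incl xs)"
    for xs :: "(complex^'m^'m) list"
  proof (induction xs)
    case Nil
    have "c *\<^sub>C (1 :: 'm ugl) = abs_ugl (Poly_Mapping.single (Word []) c)"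
      by (simp add: one_ugl.abs_eq cscale_ugl.abs_eq zero_word_def)
    then show ?case by simp
  next
    case (Cons x xs)
    have "Poly_Mapping.single (Word (x # xs)) c = letter x * Poly_Mapping.single (Word xs) c"
      by (simp add: letter_def mult_single plus_word_def)
    then have "abs_ugl (Poly_Mapping.single (Word (x # xs)) c) = abs_ugl (letter x) * abs_ugl (Poly_Mapping.single (Word xs) c)"
      by (simp add: times_ugl.abs_eq)
    then show ?case
      by (simp add: Cons ugl_incl.abs_eq)
  qed
  then show ?case
    by (cases w) (simp add: free_eval_def word_eval_def)
qed

lemma ugl_universal:
  assumes f: "gl_lie_hom f"
  obtains g where "calgebra_hom g" "\<And>A. g (ugl_incl A) = f A"
proof
  define g where "g = (\<lambda>u. free_eval f (rep_ugl u))"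
  have g: "g (abs_ugl p) = free_eval f p" for p
  proof -
    have "ugl_equiv (rep_ugl (abs_ugl p)) p"
      by (rule Quotient_rep_abs[OF Quotient_ugl]) (rule ugl_equiv_eqI[OF refl])
    then show ?thesis
      using free_eval_ideal[OF f, of "rep_ugl (abs_ugl p) - p"]
      by (simp add: g_def ugl_equiv_def free_eval_diff)
  qed
  show "g (ugl_incl A) = f A" for A
    by (simp add: ugl_incl.abs_eq g)
  have "g (x + y) = g x + g y" for x y
    by (induction x rule: ugl.abs_induct, induction y rule: ugl.abs_induct)
      (simp add: plus_ugl.abs_eq g free_eval_add)
  moreover have "g (x * y) = g x * g y" for x y
    by (induction x rule: ugl.abs_induct, induction y rule: ugl.abs_induct)
      (simp add: times_ugl.abs_eq g free_eval_mult)
  moreover have "g (c *\<^sub>C x) = c *\<^sub>C g x" for c x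
    by (induction x rule: ugl.abs_induct) (simp add: cscale_ugl.abs_eq g free_eval_scale)
  moreover have "g 1 = 1"
    by (simp add: one_ugl.abs_eq g)
  ultimately show "calgebra_hom g"
    by (simp add: calgebra_hom_def)
qed

lemma calgebra_hom_sum:
  assumes "calgebra_hom f"
  shows "f (sum h A) = (\<Sum>x\<in>A. f (h x))"
proof -
  have "f 0 = 0"
    using assms unfolding calgebra_hom_def by (metis add_cancel_right_right)
  then show ?thesis
    by (induction A rule: infinite_finite_induct) (use assms in \<open>auto simp: calgebra_hom_def\<close>)
qed

lemma mat_elem_expansion: "A = (\<Sum>i\<in>UNIV. \<Sum>j\<in>UNIV. mat_cscale (A $ i $ j) (elem_mat i j))"
proof -
  have *: "x * (if k = i \<and> l = j then 1 else 0) = (if k = i then if l = j then x else 0 else 0)"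
    for x :: complex and k i l j :: 'a by simp
  have **: "(\<Sum>j\<in>UNIV. if k = i then if l = j then A $ i $ j else 0 else 0) = (if k = i then A $ i $ l else 0)"
    for k l i by simp
  show ?thesis
    by (simp add: vec_eq_iff mat_cscale_def elem_mat_def * ** sum_component)
qed

lemma gl_lie_hom_sum:
  assumes "gl_lie_hom f"
  shows "f (sum h A) = (\<Sum>x\<in>A. f (h x))"
proof -
  have "f 0 = 0"
    using assms unfolding gl_lie_hom_def by (metis add_cancel_right_right)
  then show ?thesis
    by (induction A rule: infinite_finite_induct) (use assms in \<open>auto simp: gl_lie_hom_def\<close>)
qed

lemma calgebra_hom_free_eval:
  assumes "calgebra_hom f"
  shows "f (free_eval h p) = free_eval (\<lambda>x. f (h x)) p"
proof -
  have "f (prod_list (map h xs)) = prod_list (map (\<lambda>x. f (h x)) xs)" for xs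
    by (induction xs) (use assms in \<open>auto simp: calgebra_hom_def\<close>)
  then show ?thesis
    using assms
    by (simp add: free_eval_def cextend_def calgebra_hom_sum word_eval_def)
      (simp add: calgebra_hom_def)
qed

lemma ugl_hom_eqI:
  assumes f: "calgebra_hom f" and g: "calgebra_hom g" and "\<And>i j. f (UE i j) = g (UE i j)"
  shows "f = g"
proof
  fix u :: "'a ugl"
  have "f (ugl_incl A) = g (ugl_incl A)" for A
  proof -
    have "ugl_incl A = (\<Sum>i\<in>UNIV. \<Sum>j\<in>UNIV. (A $ i $ j) *\<^sub>C UE i j)"
      by (subst mat_elem_expansion)
        (simp add: gl_lie_hom_sum[OF ugl_incl_lie_hom] ugl_incl_scale UE_def)
    with assms show ?thesis
      by (simp add: calgebra_hom_sum) (simp add: calgebra_hom_def)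
  qed
  then have "(\<lambda>A. f (ugl_incl A)) = (\<lambda>A. g (ugl_incl A))" ..
  then show "f u = g u"
    by (induction u rule: ugl.abs_induct)
      (simp add: abs_ugl_eq calgebra_hom_free_eval[OF f] calgebra_hom_free_eval[OF g])
qed

lemma elem_mat_mult: "elem_mat a b ** elem_mat c d = (if b = c then elem_mat a d else 0)"
proof -
  have "(if k = a \<and> m = b then 1 else 0) * (if m = c \<and> l = d then 1 else 0) =
      (if m = b then if k = a \<and> b = c \<and> l = d then 1 else 0 else (0::complex))" for k m l :: 'a
    by auto
  then show ?thesis
    by (auto simp: vec_eq_iff elem_mat_def matrix_matrix_mult_def)
qed

lemma UE_commutator:
  "UE a b * UE c d - UE c d * UE a b = (if b = c then UE a d else 0) - (if d = a then UE c b else 0)"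
proof -
  have zero: "ugl_incl 0 = (0 :: 'a ugl)"
    using gl_lie_hom_sum[OF ugl_incl_lie_hom, of "\<lambda>_. 0" "{}"] by simp
  have diff: "ugl_incl (A - B) = ugl_incl A - ugl_incl B" for A B :: "complex^'a^'a"
    using ugl_incl_add[of "A - B" B] by simp
  show ?thesis
    unfolding UE_def ugl_incl_bracket[symmetric] elem_mat_mult diff by (simp add: zero)
qed

lemma lie_hom_from_generators:
  fixes r :: "'m::finite \<Rightarrow> 'm \<Rightarrow> 'a::calgebra_1"
  assumes r: "\<And>a b c d. r a b * r c d - r c d * r a b =
      (if b = c then r a d else 0) - (if d = a then r c b else 0)"
  obtains f where "gl_lie_hom f" "\<And>a b. f (elem_mat a b) = r a b"
proof
  define f where "f = (\<lambda>A::complex^'m^'m. \<Sum>a\<in>UNIV. \<Sum>b\<in>UNIV. (A $ a $ b) *\<^sub>C r a b)"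
  have f_add: "f (A + B) = f A + f B" for A B
    by (simp add: f_def cscale_add_left sum.distrib)
  have f_scale: "f (mat_cscale c A) = c *\<^sub>C f A" for c A
    by (simp add: f_def mat_cscale_def calg.scale_sum_right)
  have f_diff: "f (A - B) = f A - f B" for A B
    using f_add[of "A - B" B] by simp
  have f_mult: "f (A ** B) = (\<Sum>a\<in>UNIV. \<Sum>b\<in>UNIV. \<Sum>c\<in>UNIV. \<Sum>d\<in>UNIV.
      (A $ a $ b * B $ c $ d) *\<^sub>C (if b = c then r a d else 0))" for A B :: "complex^'m^'m"
  proof -
    have "f (A ** B) = (\<Sum>a\<in>UNIV. \<Sum>d\<in>UNIV. \<Sum>b\<in>UNIV. (A $ a $ b * B $ b $ d) *\<^sub>C r a d)"
      by (simp add: f_def matrix_matrix_mult_def calg.scale_sum_left)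
    also have "\<dots> = (\<Sum>a\<in>UNIV. \<Sum>b\<in>UNIV. \<Sum>d\<in>UNIV. (A $ a $ b * B $ b $ d) *\<^sub>C r a d)"
      by (rule sum.cong[OF refl], rule sum.swap)
    also have "\<dots> = (\<Sum>a\<in>UNIV. \<Sum>b\<in>UNIV. \<Sum>d\<in>UNIV. \<Sum>c\<in>UNIV.
      (A $ a $ b * B $ c $ d) *\<^sub>C (if b = c then r a d else 0))"
      by (simp add: if_distrib[of "\<lambda>x. _ *\<^sub>C x"] cong: if_cong)
    also have "\<dots> = (\<Sum>a\<in>UNIV. \<Sum>b\<in>UNIV. \<Sum>c\<in>UNIV. \<Sum>d\<in>UNIV.
      (A $ a $ b * B $ c $ d) *\<^sub>C (if b = c then r a d else 0))"
      by (rule sum.cong[OF refl], rule sum.cong[OF refl], rule sum.swap)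
    finally show ?thesis .
  qed
  have swap: "(\<Sum>a\<in>UNIV. \<Sum>b\<in>UNIV. \<Sum>c\<in>UNIV. \<Sum>d\<in>UNIV. h a b c d) =
      (\<Sum>c\<in>UNIV. \<Sum>d\<in>UNIV. \<Sum>a\<in>UNIV. \<Sum>b\<in>UNIV. h a b c d)" for h :: "'m \<Rightarrow> 'm \<Rightarrow> 'm \<Rightarrow> 'm \<Rightarrow> 'a"
  proof -
    have pair: "(\<Sum>a\<in>UNIV. \<Sum>b\<in>UNIV. k a b) = (\<Sum>p\<in>UNIV. k (fst p) (snd p))" for k :: "'m \<Rightarrow> 'm \<Rightarrow> 'a"
      by (simp add: sum.cartesian_product UNIV_Times_UNIV case_prod_unfold)
    show ?thesis
      by (simp only: pair) (rule sum.swap)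
  qed
  have prod: "f A * f B = (\<Sum>a\<in>UNIV. \<Sum>b\<in>UNIV. \<Sum>c\<in>UNIV. \<Sum>d\<in>UNIV.
      (A $ a $ b * B $ c $ d) *\<^sub>C (r a b * r c d))" for A B
    by (simp only: f_def sum_distrib_right) (simp add: sum_distrib_left mult.commute)
  have prod': "f B * f A = (\<Sum>a\<in>UNIV. \<Sum>b\<in>UNIV. \<Sum>c\<in>UNIV. \<Sum>d\<in>UNIV.
      (A $ a $ b * B $ c $ d) *\<^sub>C (r c d * r a b))" for A B
    by (subst prod, subst swap) (simp add: mult.commute)
  have f_mult': "f (B ** A) = (\<Sum>a\<in>UNIV. \<Sum>b\<in>UNIV. \<Sum>c\<in>UNIV. \<Sum>d\<in>UNIV.
      (A $ a $ b * B $ c $ d) *\<^sub>C (if d = a then r c b else 0))" for A B :: "complex^'m^'m"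
    by (subst f_mult, subst swap) (simp add: mult.commute)
  have f_bracket: "f (A ** B - B ** A) = f A * f B - f B * f A" for A B
    unfolding f_diff f_mult[of A B] f_mult'[of B A] prod[of A B] prod'[of B A]
    by (simp only: r flip: sum_subtractf calg.scale_right_diff_distrib)
  show "gl_lie_hom f"
    by (simp add: gl_lie_hom_def f_add f_scale f_bracket)
  have "(if a' = a \<and> b' = b then 1 else 0) *\<^sub>C r a' b' =
      (if a' = a then if b' = b then r a b else 0 else 0)" for a a' b b'
    by simp
  moreover have "(\<Sum>b'\<in>UNIV. if a' = a then if b' = b then r a b else 0 else 0) = (if a' = a then r a b else 0)"
    for a a' b by simp
  ultimately show "f (elem_mat a b) = r a b" for a b
    by (simp add: f_def elem_mat_def)
qed


subsection \<open>Existence and uniqueness of \<open>\<rho>\<close>\<close>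

definition bracket :: "'a::ring \<Rightarrow> 'a \<Rightarrow> 'a"
  where "bracket x y = x * y - y * x"

lemma bracket_add_left: "bracket (x + x') y = bracket x y + bracket x' y"
  and bracket_add_right: "bracket x (y + y') = bracket x y + bracket x y'"
  and bracket_diff_left: "bracket (x - x') y = bracket x y - bracket x' y"
  and bracket_diff_right: "bracket x (y - y') = bracket x y - bracket x y'"
  and bracket_zero_left [simp]: "bracket 0 y = 0"
  and bracket_zero_right [simp]: "bracket x 0 = 0"
  and bracket_swap: "bracket x y = - bracket y x"
  by (simp_all add: bracket_def algebra_simps)

lemma bracket_sum_left: "bracket (sum g A) y = (\<Sum>i\<in>A. bracket (g i) y)"
  and bracket_sum_right: "bracket y (sum g A) = (\<Sum>i\<in>A. bracket y (g i))"
  by (simp_all add: bracket_def sum_distrib_left sum_distrib_right sum_subtractf)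

lemma bracket_cscale_left: "bracket (c *\<^sub>C x) y = c *\<^sub>C bracket x (y :: 'a::calgebra_1)"
  by (simp add: bracket_def calg.scale_right_diff_distrib)

lemma tensor_diff_left: "(a - a') \<otimes> b = a \<otimes> b - a' \<otimes> b"
  using tensor_add_left[of "a - a'" a' b] by simp

lemma tensor_diff_right: "a \<otimes> (b - b') = a \<otimes> b - a \<otimes> b'"
  using tensor_add_right[of a "b - b'" b'] by simp

lemma tensor_zero_left [simp]: "0 \<otimes> b = 0"
  using tensor_diff_left[of 0 0 b] by simp

lemma tensor_zero_right [simp]: "a \<otimes> 0 = 0"
  using tensor_diff_right[of a 0 0] by simp

lemma tensor_uminus_left: "(- a) \<otimes> b = - (a \<otimes> b)"
  using tensor_diff_left[of 0 a b] by simp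

lemma tensor_uminus_right: "a \<otimes> (- b) = - (a \<otimes> b)"
  using tensor_diff_right[of a 0 b] by simp

lemma tensor_if_left: "(if P then a else 0) \<otimes> b = (if P then a \<otimes> b else 0)"
  by simp

lemma tensor_if_right: "a \<otimes> (if P then b else 0) = (if P then a \<otimes> b else 0)"
  by simp

lemma bracket_tensor_left: "b * b' = b' * b \<Longrightarrow> bracket (a \<otimes> b) (a' \<otimes> b') = bracket a a' \<otimes> (b * b')"
  by (simp add: bracket_def tensor_mult tensor_diff_left)

lemma bracket_tensor_right: "a * a' = a' * a \<Longrightarrow> bracket (a \<otimes> b) (a' \<otimes> b') = (a * a') \<otimes> bracket b b'"
  by (simp add: bracket_def tensor_mult tensor_diff_right)

lemma sum_option: "(\<Sum>j\<in>UNIV. g j) = g None + (\<Sum>i\<in>UNIV. g (Some i))"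
  for g :: "'n::finite option \<Rightarrow> 'a::comm_monoid_add"
  by (simp add: UNIV_option_conv sum.reindex)

lemma bracket_tt: "bracket (t_partial a b) (t_partial c d) =
    (if b = c then t_partial a d else 0) - (if d = a then t_partial c b else 0)"
  by (simp only: bracket_def t_partial_commutator)

lemma bracket_UE: "bracket (UE a b) (UE c d) =
    (if b = c then UE a d else 0) - (if d = a then UE c b else 0)"
  by (simp only: bracket_def UE_commutator)

lemma bracket_t_ratio:
  "bracket (t_partial None (Some b)) (t_ratio i) = (if b = i then 1 else 0)"
  "bracket (t_partial (Some a) (Some b)) (t_ratio i) = (if b = i then t_ratio a else 0)"
  "bracket (t_partial None None) (t_ratio i) = - t_ratio i"
  "bracket (t_partial (Some a) None) (t_ratio i) = - (t_ratio a * t_ratio i)"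
  by (simp_all only: bracket_def t_partial_ratio_commutator)

lemma bracket_euler_t_partial: "bracket euler (t_partial a b) = 0"
proof -
  have "bracket (t_partial i i) (t_partial a b) =
      (if i = a then t_partial a b else 0) - (if i = b then t_partial a b else 0)" for i
    by (auto simp: bracket_tt)
  then show ?thesis
    by (simp add: euler_def bracket_sum_left sum_subtractf)
qed

lemma bracket_euler_t_ratio: "bracket euler (t_ratio i) = 0"
  by (simp add: euler_def bracket_sum_left sum_option bracket_add_left bracket_t_ratio)

lemma gelfand_1: "gelfand 1 = (\<Sum>i\<in>UNIV. UE i i)"
  by (simp add: gelfand_def trace_def UE_matrix_def)

lemma bracket_gelfand_1: "bracket (gelfand 1) (UE a b) = 0"
proof -
  have "bracket (UE i i) (UE a b) = (if i = a then UE a b else 0) - (if i = b then UE a b else 0)" for i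
    by (auto simp: bracket_UE)
  then show ?thesis
    by (simp add: gelfand_1 bracket_sum_left sum_subtractf del: One_nat_def)
qed

lemma bracket_R1:
  assumes "bracket euler x = 0" "bracket (gelfand 1) u = 0"
  shows "bracket R1 (x \<otimes> u) = 0"
  using assms
  unfolding R1_def bracket_cscale_left
  by (simp add: bracket_add_left bracket_tensor_left bracket_tensor_right del: One_nat_def)

lemma bracket_one_right [simp]: "bracket x 1 = 0" for x :: "'a::ring_1"
  by (simp add: bracket_def)

lemma bracket_one_left [simp]: "bracket 1 x = 0" for x :: "'a::ring_1"
  by (simp add: bracket_def)

definition rho_Q :: "'n \<Rightarrow> ('n::finite dprime, 'n ugl) tensor"
  where "rho_Q a = (\<Sum>i\<in>UNIV. t_ratio i \<otimes> UE a i)"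

definition rho_S :: "'n \<Rightarrow> 'n \<Rightarrow> ('n::finite dprime, 'n ugl) tensor"
  where "rho_S a c = (\<Sum>i\<in>UNIV. (t_ratio a * t_ratio i) \<otimes> UE c i)"

lemma bracket_R1_left:
  "bracket R1 (t_partial a b \<otimes> 1) = 0" "bracket R1 (1 \<otimes> UE c d) = 0" "bracket R1 (rho_Q c) = 0"
  "bracket R1 R1 = 0"
  by (simp_all add: rho_Q_def bracket_sum_right bracket_R1 bracket_euler_t_partial
      bracket_euler_t_ratio bracket_gelfand_1 del: One_nat_def)
    (simp add: bracket_def)

lemma bracket_R1_right:
  "bracket (t_partial a b \<otimes> 1) R1 = 0" "bracket (1 \<otimes> UE c d) R1 = 0" "bracket (rho_Q c) R1 = 0"
  by (simp_all add: bracket_swap[of _ R1] bracket_R1_left)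

lemma bracket_PE: "bracket (t_partial a b \<otimes> 1) (1 \<otimes> UE c d) = 0" "bracket (1 \<otimes> UE c d) (t_partial a b \<otimes> 1) = 0"
  by (simp_all add: bracket_tensor_left)

lemma bracket_PP: "bracket (t_partial a b \<otimes> 1) (t_partial c d \<otimes> 1) =
    (if b = c then t_partial a d \<otimes> 1 else 0) - (if d = a then t_partial c b \<otimes> 1 else 0)"
  by (simp add: bracket_tensor_left bracket_tt tensor_diff_left tensor_uminus_left)

lemma bracket_EE: "bracket (1 \<otimes> UE a b) (1 \<otimes> UE c d) =
    (if b = c then 1 \<otimes> UE a d else 0) - (if d = a then 1 \<otimes> UE c b else 0)"
  by (simp add: bracket_tensor_right bracket_UE tensor_diff_right tensor_uminus_right)

lemma bracket_PQ:
  "bracket (t_partial (Some a) (Some b) \<otimes> 1) (rho_Q c) = t_ratio a \<otimes> UE c b"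
  "bracket (t_partial None (Some b) \<otimes> 1) (rho_Q c) = 1 \<otimes> UE c b"
  "bracket (t_partial None None \<otimes> 1) (rho_Q c) = - rho_Q c"
  "bracket (t_partial (Some a) None \<otimes> 1) (rho_Q c) = - rho_S a c"
  by (simp_all add: rho_Q_def rho_S_def bracket_sum_right bracket_tensor_left bracket_t_ratio
      tensor_if_left tensor_uminus_left sum_negf)

lemma bracket_EQ: "bracket (1 \<otimes> UE a b) (rho_Q c) = (if b = c then rho_Q a else 0) - t_ratio a \<otimes> UE c b"
  by (simp add: rho_Q_def bracket_sum_right bracket_tensor_right bracket_UE
      tensor_diff_right tensor_if_right sum_subtractf)

lemma bracket_QQ: "bracket (rho_Q a) (rho_Q c) = rho_S c a - rho_S a c"
proof -
  have if_sum: "(\<Sum>i\<in>UNIV. if P then g i else 0) = (if P then \<Sum>i\<in>UNIV. g i else 0)"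
    for P and g :: "'a \<Rightarrow> ('a dprime, 'a ugl) tensor"
    by simp
  show ?thesis
    by (simp add: rho_Q_def rho_S_def bracket_sum_right bracket_sum_left bracket_tensor_right t_ratio_commute
        bracket_UE tensor_diff_right tensor_if_right sum_subtractf if_sum)
qed

lemma bracket_QP:
  "bracket (rho_Q c) (t_partial (Some a) (Some b) \<otimes> 1) = - (t_ratio a \<otimes> UE c b)"
  "bracket (rho_Q c) (t_partial None (Some b) \<otimes> 1) = - (1 \<otimes> UE c b)"
  "bracket (rho_Q c) (t_partial None None \<otimes> 1) = rho_Q c"
  "bracket (rho_Q c) (t_partial (Some a) None \<otimes> 1) = rho_S a c"
  by (simp_all add: bracket_swap[of "rho_Q c"] bracket_PQ)

lemma bracket_QE: "bracket (rho_Q c) (1 \<otimes> UE a b) = t_ratio a \<otimes> UE c b - (if b = c then rho_Q a else 0)"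
  by (simp add: bracket_swap[of "rho_Q c"] bracket_EQ)

lemma rho_gen_bracket:
  "bracket (rho_gen a b) (rho_gen c d) = (if b = c then rho_gen a d else 0) - (if d = a then rho_gen c b else 0)"
proof -
  have if_left: "bracket (if P then R1 else 0) y = (if P then bracket R1 y else 0)"
    and if_right: "bracket y (if P then R1 else 0) = (if P then bracket y R1 else 0)"
    for P and y :: "('a dprime, 'a ugl) tensor"
    by auto
  show ?thesis
    by (cases a; cases b; cases c; cases d)
      (simp_all add: bracket_add_left bracket_add_right bracket_diff_left bracket_diff_right
        if_left if_right bracket_R1_left bracket_R1_right bracket_PE bracket_PP bracket_EE
        bracket_PQ bracket_EQ bracket_QQ bracket_QP bracket_QE flip: rho_Q_def)
qed

lemma rho_ex1:
  "\<exists>!f. calgebra_hom f \<and> (\<forall>i j :: 'n::finite option. f (UE i j) = rho_gen i j)"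
proof (rule ex_ex1I)
  obtain f :: "complex^'n option^'n option \<Rightarrow> ('n dprime, 'n ugl) tensor"
    where f: "gl_lie_hom f" "\<And>a b. f (elem_mat a b) = rho_gen a b"
    using lie_hom_from_generators[of rho_gen, OF rho_gen_bracket[unfolded bracket_def]] by blast
  obtain g where "calgebra_hom g" "\<And>A. g (ugl_incl A) = f A"
    using ugl_universal[OF f(1)] by blast
  then show "\<exists>f. calgebra_hom f \<and> (\<forall>i j :: 'n option. f (UE i j) = rho_gen i j)"
    using f(2) by (auto simp: UE_def)
next
  fix f g :: "'n option ugl \<Rightarrow> ('n dprime, 'n ugl) tensor"
  assume "calgebra_hom f \<and> (\<forall>i j. f (UE i j) = rho_gen i j)"
    and "calgebra_hom g \<and> (\<forall>i j. g (UE i j) = rho_gen i j)"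
  then show "f = g"
    by (intro ugl_hom_eqI) auto
qed

lemma rho_hom: "calgebra_hom rho"
  and rho_UE: "rho (UE i j) = rho_gen i j"
  using theI'[OF rho_ex1] unfolding rho_def by blast+

end

theory Submission
  imports Defs
begin

text \<open>
  Let \<open>L\<close> be the matrix with the entries \<open>\<rho>(E\<^sub>i\<^sub>j)\<close>, so that \<open>\<rho>(G\<^sub>k)\<close> is \<open>tr L\<^sup>k\<close>. It splits as \<open>L = R\<^sub>1 I + M\<close> and
  \<open>M = T + A\<close>, where \<open>T\<close> has the entries \<open>t\<^sub>i\<partial>\<^sub>j \<otimes> 1\<close> and \<open>A\<close> collects everything that
  involves \<open>gl(n)\<close>: its row \<open>0\<close> vanishes, its lower right block is \<open>1 \<otimes> E\<close>, and its column
  \<open>0\<close> is \<open>- E x\<close> with \<open>x\<^sub>i = t\<^sub>i/t\<^sub>0\<close>. Two relations make the powers of \<open>M\<close> computable.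

  \<^item> \<open>A T = 0\<close>, since every column of \<open>T\<close> is a multiple of the vector \<open>(t\<^sub>0, \<dots>, t\<^sub>n)\<close>, and the
    column \<open>0\<close> of \<open>A\<close> is chosen so that this vector is annihilated.

  \<^item> \<open>T T = R\<^sub>2 T\<close>, since \<open>T\<close> is the column of the \<open>t\<^sub>i\<close> times the row of the \<open>\<partial>\<^sub>k\<close>: the entries of the
    square are \<open>t\<^sub>i (\<Sum>\<^sub>j \<partial>\<^sub>j t\<^sub>j) \<partial>\<^sub>k = t\<^sub>i (\<E> + n + 1) \<partial>\<^sub>k = (\<E> + n) t\<^sub>i \<partial>\<^sub>k\<close>, as \<open>\<E> t\<^sub>i = t\<^sub>i (\<E> + 1)\<close>.

  By the first relation no factor \<open>A\<close> can precede a factor \<open>T\<close> in the expansion of \<open>(T + A)\<^sup>k\<close>, and each trace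
  \<open>tr M\<^sup>k\<close> with \<open>k \<ge> 1\<close> reduces to \<open>tr T\<close>, \<open>tr A\<^sup>k\<close> and the mixed traces \<open>tr (T A\<^sup>j)\<close>
  (\<open>trace_mpow_add\<close>). These are \<open>\<E> \<otimes> 1\<close>, \<open>1 \<otimes> G\<^sub>k\<close> and \<open>- 1 \<otimes> G\<^sub>j\<close>: in the last one the row
  \<open>0\<close> and the other rows of \<open>T\<close> contribute terms of opposite sign that differ only in the order of \<open>t\<^sub>0\<partial>\<^sub>a\<close> and
  \<open>t\<^sub>b/t\<^sub>0\<close>, and the commutator of these two operators is \<open>\<delta>\<^sub>a\<^sub>b\<close> (\<open>trace_T_mpow_A\<close>). Finally \<open>R\<^sub>1\<close>
  commutes with the entries of \<open>M\<close>, so the binomial theorem gives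
  \<open>tr L\<^sup>k = \<Sum>\<^sub>g (k choose g) R\<^sub>1\<^sup>g tr M\<^sup>k\<^sup>-\<^sup>g\<close> (\<open>trace_mpow_add_scalar\<close>), and the summand \<open>g = k\<close> is
  the term \<open>(n + 1) R\<^sub>1\<^sup>k\<close>.
\<close>

section \<open>Powers and traces of matrices over a noncommutative ring\<close>

definition mpow :: "'a::ring_1^'n^'n \<Rightarrow> nat \<Rightarrow> 'a^'n^'n"
  where "mpow A k = ((\<lambda>M. A ** M) ^^ k) (mat 1)"

lemma mpow_0 [simp]: "mpow A 0 = mat 1"
  and mpow_Suc: "mpow A (Suc k) = A ** mpow A k"
  by (simp_all add: mpow_def)

lemma mpow_1 [simp]: "mpow A (Suc 0) = A"
  by (simp add: mpow_Suc)

lemma mpow_commute: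
  assumes "B ** A = A ** B"
  shows "B ** mpow A k = mpow A k ** B"
proof (induction k)
  case (Suc k)
  have "B ** (A ** mpow A k) = A ** (B ** mpow A k)"
    by (simp add: matrix_mul_assoc assms)
  then show ?case
    by (simp add: mpow_Suc Suc.IH matrix_mul_assoc)
qed simp

lemma matrix_add_distrib_right: "(A + B) ** C = A ** C + B ** C"
  for A B :: "'a::semiring_1^'n^'m"
  by (simp add: vec_eq_iff matrix_matrix_mult_def distrib_right sum.distrib)

lemma mat_mult_nth: "(mat c ** A) $ i $ j = c * A $ i $ j"
  for A :: "'a::semiring_1^'n^'m"
  by (simp add: matrix_matrix_mult_def mat_def if_distrib if_distribR sum.delta'[OF finite] cong: if_cong)

lemma mult_mat_nth: "(A ** mat c) $ i $ j = A $ i $ j * c"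
  for A :: "'a::semiring_1^'n^'m"
  by (simp add: matrix_matrix_mult_def mat_def if_distrib if_distribR sum.delta[OF finite] cong: if_cong)

lemma trace_mat_mult: "trace (mat c ** A) = c * trace A"
  by (simp add: trace_def mat_mult_nth sum_distrib_left)

lemma trace_plus: "trace (A + B) = trace A + trace B"
  by (simp add: trace_def sum.distrib)

lemma calgebra_hom_mpow_nth:
  assumes "calgebra_hom f"
  shows "f (mpow A k $ i $ j) = mpow (\<chi> i j. f (A $ i $ j)) k $ i $ j"
proof (induction k arbitrary: i j)
  case 0
  have "f 0 = 0"
    using calgebra_hom_sum[OF assms, of "\<lambda>_. 0" "{}"] by simp
  then show ?case
    using assms by (simp add: mat_def calgebra_hom_def)
next
  case (Suc k)
  have "f (x * y) = f x * f y" for x y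
    using assms by (simp add: calgebra_hom_def)
  then show ?case
    by (simp add: mpow_Suc matrix_matrix_mult_def calgebra_hom_sum[OF assms] Suc.IH)
qed

lemma calgebra_hom_gelfand:
  assumes "calgebra_hom f"
  shows "f (gelfand k) = trace (mpow (\<chi> i j. f (UE i j)) k)"
  by (simp add: gelfand_def trace_def calgebra_hom_sum[OF assms] UE_matrix_def
      calgebra_hom_mpow_nth[OF assms] flip: mpow_def)

text \<open>
  The recurrence satisfied by \<open>Y k m = (b + c)\<^sup>k b\<^sup>m\<close> when \<open>c\<close> is central. Only this recurrence
  enters the expansion, so it applies to any additive image of these products, such as a trace.
\<close>

lemma binomial_recurrence:
  fixes c :: "'a::ring_1"
  assumes rec: "\<And>k m. Y (Suc k) m = Y k (Suc m) + c * Y k m"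
  shows "Y k m = (\<Sum>g=0..k. of_nat (k choose g) * c ^ g * Y 0 (m + k - g))"
proof (induction k arbitrary: m)
  case (Suc k)
  let ?t = "\<lambda>g. c ^ g * Y 0 (m + Suc k - g)"
  have "Y k (Suc m) = (\<Sum>g=0..Suc k. of_nat (k choose g) * ?t g)"
    by (simp add: Suc.IH mult.assoc binomial_eq_0)
  also have "\<dots> = ?t 0 + (\<Sum>g=0..k. of_nat (k choose Suc g) * ?t (Suc g))"
    by (simp only: sum.atLeast0_atMost_Suc_shift) simp
  finally have 1: "Y k (Suc m) = ?t 0 + (\<Sum>g=0..k. of_nat (k choose Suc g) * ?t (Suc g))" .
  have "c * (of_nat b * c ^ g * y) = of_nat b * (c ^ Suc g * y)" for b g y
    by (simp add: mult.assoc power_commutes)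
      (metis mult.assoc mult_of_nat_commute)
  then have 2: "c * Y k m = (\<Sum>g=0..k. of_nat (k choose g) * ?t (Suc g))"
    by (simp add: Suc.IH sum_distrib_left)
  have "(\<Sum>g=0..Suc k. of_nat (Suc k choose g) * ?t g)
      = ?t 0 + (\<Sum>g=0..k. of_nat (k choose g) * ?t (Suc g))
        + (\<Sum>g=0..k. of_nat (k choose Suc g) * ?t (Suc g))"
    by (simp only: sum.atLeast0_atMost_Suc_shift) (simp add: distrib_right sum.distrib add.assoc)
  then show ?case
    by (simp only: rec 1 2 mult.assoc add.assoc add.commute add.left_commute)
qed simp

lemma trace_mpow_add_scalar:
  fixes B :: "'a::ring_1^'n^'n"
  assumes comm: "\<And>i j. c * B $ i $ j = B $ i $ j * c"
  shows "trace (mpow (B + mat c) k) = (\<Sum>g=0..k. of_nat (k choose g) * c ^ g * trace (mpow B (k - g)))"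
proof -
  define Y where "Y = (\<lambda>k m. trace (mpow B m ** mpow (B + mat c) k))"
  have comm': "mat c ** mpow B m = mpow B m ** mat c" for m
    by (intro mpow_commute) (simp add: vec_eq_iff mat_mult_nth mult_mat_nth comm)
  have "Y (Suc k) m = Y k (Suc m) + c * Y k m" for k m
  proof -
    have "mpow B m ** mpow (B + mat c) (Suc k)
        = (mpow B m ** B) ** mpow (B + mat c) k + (mpow B m ** mat c) ** mpow (B + mat c) k"
      by (simp add: mpow_Suc matrix_add_distrib_right matrix_add_ldistrib matrix_mul_assoc)
    also have "\<dots> = mpow B (Suc m) ** mpow (B + mat c) k
        + mat c ** (mpow B m ** mpow (B + mat c) k)"
      by (simp add: mpow_Suc matrix_mul_assoc mpow_commute[OF refl] flip: comm')
    finally show ?thesis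
      by (simp add: Y_def trace_plus trace_mat_mult)
  qed
  from binomial_recurrence[of Y c k 0, OF this] show ?thesis
    by (simp add: Y_def)
qed

text \<open>
  As \<open>A T = 0\<close>, the product \<open>A M\<^sup>k\<close> with \<open>M = T + A\<close> is \<open>A\<^sup>k\<^sup>+\<^sup>1\<close>. Splitting off the first factor
  therefore gives \<open>M\<^sup>k\<^sup>+\<^sup>1 = T M\<^sup>k + A\<^sup>k\<^sup>+\<^sup>1\<close>, and \<open>T T = c T\<close> turns \<open>T M\<^sup>k\<^sup>+\<^sup>1\<close> into
  \<open>c T M\<^sup>k + T A\<^sup>k\<^sup>+\<^sup>1\<close>, which is a first order recurrence for the remaining trace.
\<close>

lemma trace_mpow_add:
  fixes T A :: "'a::ring_1^'n^'n"
  assumes AT: "A ** T = 0" and TT: "T ** T = mat c ** T"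
  shows "trace (mpow (T + A) (Suc k)) =
    trace (mpow A (Suc k)) + c ^ k * trace T + (\<Sum>j=1..k. c ^ (k - j) * trace (T ** mpow A j))"
proof -
  let ?M = "T + A"
  have AM: "A ** mpow ?M k = mpow A (Suc k)" for k
  proof (induction k)
    case (Suc k)
    have "A ** mpow ?M (Suc k) = (A ** T + A ** A) ** mpow ?M k"
      by (simp only: mpow_Suc matrix_mul_assoc matrix_add_ldistrib)
    also have "\<dots> = A ** (A ** mpow ?M k)"
      by (simp add: AT matrix_mul_assoc)
    finally show ?case
      by (simp add: Suc.IH mpow_Suc[of A "Suc k"])
  qed simp
  have TM: "trace (T ** mpow ?M k) = c ^ k * trace T + (\<Sum>j=1..k. c ^ (k - j) * trace (T ** mpow A j))" for k
  proof (induction k)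
    case (Suc k)
    have "T ** mpow ?M (Suc k) = (T ** T) ** mpow ?M k + T ** (A ** mpow ?M k)"
      by (simp add: mpow_Suc matrix_mul_assoc matrix_add_ldistrib matrix_add_distrib_right)
    also have "\<dots> = mat c ** (T ** mpow ?M k) + T ** mpow A (Suc k)"
      by (simp only: TT AM matrix_mul_assoc)
    finally have "trace (T ** mpow ?M (Suc k)) =
        c * (c ^ k * trace T + (\<Sum>j=1..k. c ^ (k - j) * trace (T ** mpow A j))) + trace (T ** mpow A (Suc k))"
      by (simp add: trace_plus trace_mat_mult Suc.IH)
    moreover have "c * (\<Sum>j=1..k. c ^ (k - j) * trace (T ** mpow A j)) =
        (\<Sum>j=1..k. c ^ (Suc k - j) * trace (T ** mpow A j))"
      by (simp add: sum_distrib_left Suc_diff_le mult.assoc)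
    ultimately show ?case
      by (simp add: distrib_left mult.assoc add.assoc)
  qed simp
  have "mpow ?M (Suc k) = A ** mpow ?M k + T ** mpow ?M k"
    by (simp only: mpow_Suc matrix_add_distrib_right add.commute)
  then show ?thesis
    by (simp only: trace_plus TM AM add.assoc)
qed


section \<open>The two summands of the matrix of generators\<close>

definition T_matrix :: "(('n::finite dprime, 'n ugl) tensor)^'n option^'n option"
  where "T_matrix = (\<chi> i j. t_partial i j \<otimes> 1)"

definition A_matrix :: "(('n::finite dprime, 'n ugl) tensor)^'n option^'n option"
  where "A_matrix = (\<chi> i j. case i of None \<Rightarrow> 0
    | Some a \<Rightarrow> (case j of None \<Rightarrow> - (\<Sum>b\<in>UNIV. t_ratio b \<otimes> UE a b) | Some b \<Rightarrow> 1 \<otimes> UE a b))"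

lemma T_matrix_nth: "T_matrix $ i $ j = t_partial i j \<otimes> 1"
  by (simp add: T_matrix_def)

lemma A_matrix_nth:
  "A_matrix $ None $ j = 0"
  "A_matrix $ Some a $ Some b = 1 \<otimes> UE a b"
  "A_matrix $ Some a $ None = - (\<Sum>b\<in>UNIV. t_ratio b \<otimes> UE a b)"
  by (simp_all add: A_matrix_def)

lemma rho_gen_matrix: "(\<chi> i j. rho_gen i j) = T_matrix + A_matrix + mat R1"
proof -
  have "rho_gen i j = (T_matrix + A_matrix + mat R1) $ i $ j" for i j :: "'a option"
    by (cases i; cases j) (simp_all add: T_matrix_nth A_matrix_nth mat_def)
  then show ?thesis
    by (simp add: vec_eq_iff)
qed

lemma R1_commutes_entries: "R1 * (T_matrix + A_matrix) $ i $ j = (T_matrix + A_matrix) $ i $ j * R1"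
proof -
  have "bracket R1 ((T_matrix + A_matrix) $ i $ j) = 0"
    by (cases i; cases j)
      (simp_all add: T_matrix_nth A_matrix_nth bracket_add_right bracket_diff_right bracket_R1_left
        flip: rho_Q_def)
  then show ?thesis
    by (simp add: bracket_def)
qed

lemma t_ratio_t_partial: "t_ratio a * t_partial None b = t_partial (Some a) b"
proof (rule dprime_eqI)
  fix f
  have "t_var (Some a) * t0_inv * (t_var None * partial b f) = t_var (Some a) * (t0_inv * t_var None) * partial b f"
    by (simp only: mult.assoc)
  then show "Rep_dprime (t_ratio a * t_partial None b) f = Rep_dprime (t_partial (Some a) b) f"
    by (simp add: times_dprime.rep_eq t_ratio.rep_eq t_partial.rep_eq)
qed

lemma A_T_matrix: "A_matrix ** T_matrix = (0 :: (('n::finite dprime, 'n ugl) tensor)^'n option^'n option)"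
  proof -
  have "(A_matrix ** T_matrix) $ i $ k = 0" for i k :: "'n option"
    by (cases i) (simp_all add: matrix_matrix_mult_def A_matrix_nth T_matrix_nth sum_option tensor_mult
      t_ratio_t_partial sum_distrib_right)
  then show ?thesis
    by (simp add: vec_eq_iff)
qed

text \<open>Both sides are \<open>t\<^sub>i t\<^sub>j \<partial>\<^sub>j \<partial>\<^sub>k + t\<^sub>i \<partial>\<^sub>k\<close>.\<close>

lemma t_partial_mult_t_partial:
  "t_partial i j * t_partial j k = t_partial j j * t_partial i k + (if i = j then 0 else t_partial i k)"
  by transfer (auto simp: fun_eq_iff partial_mult partial_t_var algebra_simps)

text \<open>
  The term missing for \<open>j = i\<close> is what leaves \<open>n\<close> instead of the number \<open>n + 1\<close> of variables.
\<close>

lemma sum_t_partial_mult: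
  fixes i k :: "'n::finite option"
  shows "(\<Sum>j\<in>UNIV. t_partial i j * t_partial j k) = (euler + of_nat CARD('n)) * t_partial i k"
proof -
  have "(\<Sum>j\<in>UNIV. if i = j then 0 else t_partial i k) = (\<Sum>j\<in>UNIV - {i}. t_partial i k)"
    by (rule sum.mono_neutral_cong_right) auto
  also have "\<dots> = of_nat CARD('n) * t_partial i k"
    by simp
  finally show ?thesis
    by (simp add: t_partial_mult_t_partial[of i] sum.distrib euler_def distrib_right sum_distrib_right)
qed

lemma tensor_sum_left: "sum f S \<otimes> b = (\<Sum>x\<in>S. f x \<otimes> b)"
  by (induction S rule: infinite_finite_induct) (simp_all add: tensor_add_left)

lemma T_T_matrix: "T_matrix ** T_matrix = mat R2 ** T_matrix"
  by (simp add: vec_eq_iff mat_mult_nth)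
    (simp add: matrix_matrix_mult_def T_matrix_nth R2_def tensor_mult sum_t_partial_mult
      flip: tensor_sum_left)

lemma trace_T_matrix: "trace T_matrix = euler \<otimes> 1"
  by (simp add: trace_def T_matrix_nth euler_def tensor_sum_left)

lemma calgebra_hom_tensor_right: "calgebra_hom (\<lambda>u. 1 \<otimes> u)"
  by (simp add: calgebra_hom_def tensor_add_right tensor_scale_right tensor_mult tensor_one)

text \<open>
  Powers of the block matrix \<open>(0, 0 | - E x, E)\<close>: left multiplication by it multiplies both
  lower blocks of a matrix with vanishing row \<open>0\<close> by \<open>E\<close>,
  and the coordinates \<open>x\<close> sit in the other tensor factor. The exponent \<open>0\<close>
  is excluded because the upper left entry of the identity matrix is \<open>1\<close>.
\<close>

lemma mpow_A_matrix:
  fixes a b :: "'n::finite" and j :: "'n option"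
  shows "mpow A_matrix (Suc m) $ None $ j = 0"
  "mpow A_matrix (Suc m) $ Some a $ Some b = 1 \<otimes> (mpow UE_matrix (Suc m) $ a $ b)"
  "mpow A_matrix (Suc m) $ Some a $ None = - (\<Sum>b\<in>UNIV. t_ratio b \<otimes> (mpow UE_matrix (Suc m) $ a $ b))"
proof (induction m arbitrary: j a b)
  case 0
  { case 1 show ?case by (simp add: A_matrix_nth)
  next case 2 show ?case by (simp add: A_matrix_nth UE_matrix_def)
  next case 3 show ?case by (simp add: A_matrix_nth UE_matrix_def)
  }
next
  case (Suc m)
  have step: "mpow A_matrix (Suc (Suc m)) $ Some a $ j =
      (\<Sum>b\<in>UNIV. (1 \<otimes> UE a b) * mpow A_matrix (Suc m) $ Some b $ j)" for a :: 'n and j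
    by (simp add: mpow_Suc[of A_matrix "Suc m"] matrix_matrix_mult_def[of A_matrix "mpow A_matrix (Suc m)"]
        sum_option Suc.IH(1) A_matrix_nth)
  have step': "mpow UE_matrix (Suc (Suc m)) $ a $ b =
      (\<Sum>c\<in>UNIV. UE a c * mpow UE_matrix (Suc m) $ c $ b)" for a b :: 'n
    by (simp add: mpow_Suc[of UE_matrix "Suc m"] matrix_matrix_mult_def[of UE_matrix "mpow UE_matrix (Suc m)"])
      (simp add: UE_matrix_def)
  have sum_right: "x \<otimes> sum f S = (\<Sum>y\<in>S. x \<otimes> f y)" for x :: "'n dprime" and f :: "'n \<Rightarrow> 'n ugl" and S
    by (induction S rule: infinite_finite_induct) (simp_all add: tensor_add_right)
  { case 1
    show ?case
      by (simp add: mpow_Suc[of A_matrix "Suc m"] matrix_matrix_mult_def[of A_matrix "mpow A_matrix (Suc m)"]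
          A_matrix_nth)
  next
    case 2
    show ?case
      by (simp only: step step' Suc.IH sum_right tensor_mult) simp
  next
    case 3
    show ?case
      by (simp add: step step' Suc.IH sum_right tensor_mult sum_distrib_left sum_negf) (rule sum.swap)
  }
qed

lemma tensor_gelfand: "1 \<otimes> gelfand m = (\<Sum>a\<in>UNIV. 1 \<otimes> (mpow UE_matrix m $ a $ a))"
  by (simp add: gelfand_def trace_def calgebra_hom_sum[OF calgebra_hom_tensor_right] flip: mpow_def)

lemma trace_mpow_A_matrix: "trace (mpow A_matrix (Suc m)) = 1 \<otimes> gelfand (Suc m)"
  by (simp add: trace_def sum_option mpow_A_matrix tensor_gelfand)

text \<open>
  With \<open>P\<^sub>a = t\<^sub>0\<partial>\<^sub>a\<close> and \<open>t\<^sub>b\<partial>\<^sub>a = x\<^sub>b P\<^sub>a\<close>, row \<open>0\<close> of \<open>T\<close> contributes the summands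
  \<open>- P\<^sub>a x\<^sub>b \<otimes> (E\<^sup>m)\<^sub>a\<^sub>b\<close> and row \<open>b\<close> the summands \<open>x\<^sub>b P\<^sub>a \<otimes> (E\<^sup>m)\<^sub>a\<^sub>b\<close>, which cancel up to
  \<open>[P\<^sub>a, x\<^sub>b] = \<delta>\<^sub>a\<^sub>b\<close>.
\<close>

lemma trace_T_mpow_A: 
  "trace (T_matrix ** mpow A_matrix (Suc m)) = (- (1 \<otimes> gelfand (Suc m)) :: ('n::finite dprime, 'n ugl) tensor)"
proof -
  let ?E = "mpow UE_matrix (Suc m) :: ('n ugl)^'n^'n"
  have comm: "t_partial None (Some a) * t_ratio b = t_partial (Some b) (Some a) + (if a = b then 1 else 0)"
    for a b :: 'n
    using t_partial_ratio_commutator(1)[of a b] by (simp add: t_ratio_t_partial algebra_simps)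
  have "trace (T_matrix ** mpow A_matrix (Suc m)) =
      - (\<Sum>a\<in>UNIV. \<Sum>b\<in>UNIV. (t_partial None (Some a) * t_ratio b) \<otimes> ?E $ a $ b)
      + (\<Sum>b\<in>UNIV. \<Sum>a\<in>UNIV. t_partial (Some b) (Some a) \<otimes> ?E $ a $ b)"
    by (simp add: trace_def matrix_matrix_mult_def[of T_matrix "mpow A_matrix (Suc m)"] sum_option mpow_A_matrix T_matrix_nth
        sum_distrib_left tensor_mult sum_negf)
  also have "(\<Sum>b\<in>UNIV. \<Sum>a\<in>UNIV. t_partial (Some b) (Some a) \<otimes> ?E $ a $ b) =
      (\<Sum>a\<in>UNIV. \<Sum>b\<in>UNIV. t_partial (Some b) (Some a) \<otimes> ?E $ a $ b)"
    by (rule sum.swap)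
  finally show ?thesis
    by (simp add: comm tensor_add_left sum.distrib tensor_if_left tensor_gelfand)
qed

lemma trace_mpow_T_plus_A:
  "(trace (mpow (T_matrix + A_matrix) (Suc k)) :: ('n::finite dprime, 'n ugl) tensor) =
    1 \<otimes> gelfand (Suc k) + R2 ^ k * (euler \<otimes> 1) - (\<Sum>j=1..k. R2 ^ (k - j) * (1 \<otimes> gelfand j))"
proof -
  have "trace (T_matrix ** mpow A_matrix j) = (- (1 \<otimes> gelfand j) :: ('n dprime, 'n ugl) tensor)" if "j \<in> {1..k}" for j
    using trace_T_mpow_A[of "j - 1"] that by simp
  then show ?thesis
    unfolding trace_mpow_add[OF A_T_matrix T_T_matrix] trace_mpow_A_matrix trace_T_matrix
    by (simp add: sum_negf)
qed

section \<open>The image of the Gelfand invariants\<close>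

theorem theorem5p4:
  fixes k :: nat
  assumes "k \<ge> 1"
  shows "(rho (gelfand k) :: ('n::finite dprime, 'n ugl) tensor) =
      (\<Sum>g=0..k-1. of_nat (k choose g) * R1 ^ g * R2 ^ (k - 1 - g)) * (euler \<otimes> 1)
    + of_nat (CARD('n) + 1) * R1 ^ k
    + (\<Sum>g=0..k-1. of_nat (k choose g) * R1 ^ g * (1 \<otimes> gelfand (k - g)))
    - (\<Sum>m=2..k. (\<Sum>g=0..k-m. of_nat (k choose g) * R1 ^ g * R2 ^ (k - m - g))
        * (1 \<otimes> gelfand (m - 1)))"
proof -
  define b :: "nat \<Rightarrow> ('n dprime, 'n ugl) tensor" where "b = (\<lambda>g. of_nat (k choose g) * R1 ^ g)"
  define M :: "(('n dprime, 'n ugl) tensor)^'n option^'n option" where "M = T_matrix + A_matrix"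
  define G :: "nat \<Rightarrow> ('n dprime, 'n ugl) tensor" where "G = (\<lambda>j. 1 \<otimes> gelfand j)"
  have "rho (gelfand k) = trace (mpow (M + mat R1) k)"
    by (simp add: calgebra_hom_gelfand[OF rho_hom] rho_UE rho_gen_matrix M_def)
  also have "\<dots> = (\<Sum>g=0..k. b g * trace (mpow M (k - g)))"
    unfolding M_def b_def by (rule trace_mpow_add_scalar[OF R1_commutes_entries])
  also have "\<dots> = (\<Sum>g=0..k-1. b g * trace (mpow M (k - g))) + b k * trace (mpow M 0)"
    using assms by (cases k) simp_all
  also have "b k * trace (mpow M 0) = of_nat (CARD('n) + 1) * R1 ^ k"
    by (simp add: b_def trace_def mat_def card_UNIV_option mult_of_nat_commute algebra_simps)
  also have "(\<Sum>g=0..k-1. b g * trace (mpow M (k - g))) =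
      (\<Sum>g=0..k-1. b g * (G (k - g) + R2 ^ (k - 1 - g) * (euler \<otimes> 1)
        - (\<Sum>j=1..k-1-g. R2 ^ (k - 1 - g - j) * G j)))"
  proof (rule sum.cong[OF refl])
    fix g assume "g \<in> {0..k-1}"
    then have "k - g = Suc (k - 1 - g)"
      using assms by auto
    then show "b g * trace (mpow M (k - g)) = b g * (G (k - g) + R2 ^ (k - 1 - g) * (euler \<otimes> 1)
        - (\<Sum>j=1..k-1-g. R2 ^ (k - 1 - g - j) * G j))"
      by (simp only: M_def G_def trace_mpow_T_plus_A)
  qed
  also have "\<dots> = (\<Sum>g=0..k-1. b g * G (k - g)) + (\<Sum>g=0..k-1. b g * R2 ^ (k - 1 - g)) * (euler \<otimes> 1)
      - (\<Sum>g=0..k-1. \<Sum>j=1..k-1-g. b g * R2 ^ (k - 1 - g - j) * G j)"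
    by (simp add: distrib_left right_diff_distrib sum.distrib sum_subtractf sum_distrib_left
        sum_distrib_right mult.assoc)
  also have "(\<Sum>g=0..k-1. \<Sum>j=1..k-1-g. b g * R2 ^ (k - 1 - g - j) * G j) =
      (\<Sum>m=2..k. (\<Sum>g=0..k-m. b g * R2 ^ (k - m - g)) * G (m - 1))"
  proof -
    \<comment> \<open>Both sides range over the pairs with \<open>j \<ge> 1\<close> and \<open>g + j < k\<close>, where \<open>m = j + 1\<close>.\<close>
    have "(\<Sum>g=0..k-1. \<Sum>j=1..k-1-g. b g * R2 ^ (k - 1 - g - j) * G j) =
        (\<Sum>m=2..k. \<Sum>g=0..k-m. b g * R2 ^ (k - m - g) * G (m - 1))"
      unfolding sum.Sigma[OF finite_atLeastAtMost ballI[OF finite_atLeastAtMost]]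
      by (rule sum.reindex_bij_witness[of _ "\<lambda>(m, g). (g, m - 1)" "\<lambda>(g, j). (Suc j, g)"]) (auto simp: add.commute)
    then show ?thesis
      by (simp add: sum_distrib_right)
  qed
  finally show ?thesis
    by (simp add: b_def G_def algebra_simps)
qed

end
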